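(* Let $\{z^k\},\{w^k\}$ be generated by the random iterations $$\bar z^k=\tau z^k+(1-\tau)w^k,\quad z^{k+1/2}=\mathrm{prox}_{\gamma h}(\bar z^k-\gamma g^k),\quad z^{k+1}=\mathrm{prox}_{\gamma h}(\bar z^k-\gamma g^{k+1/2}),$$ $$w^{k+1}=z^{k+1}\ \text{with probability } 1-\tau,\qquad w^{k+1}=w^k\ \text{otherwise},$$ with $\tau\in[0,1)$, step size $\gamma>0$ and $z^0=w^0\in\mathcal Z$. Suppose that for all $k$ $$\mathbb{E}[g^{k+1/2}\mid z^{k+1/2}]=F(z^{k+1/2}),$$ and that there exist constants $A,B,C,E,D_1,D_2,D_3\ge 0$, $\rho\in(0,1]$ and a (possibly zero) random sequence $\{\sigma_k\}$ such that for all $k$ $$\mathbb{E}\|g^{k+1/2}-g^k\|^2\le A\,\mathbb{E}\|z^{k+1/2}-w^k\|^2+B\,\mathbb{E}[\sigma_k^2]+D_1,$$ $$\mathbb{E}[\sigma_{k+1}^2]\le(1-\rho)\mathbb{E}[\sigma_k^2]+C\,\mathbb{E}\|z^{k+1/2}-w^k\|^2+D_2,$$ $$\mathbb{E}\|g^{k+1/2}-F(z^{k+1/2})\|^2\le E\,\mathbb{E}\|z^{k+1/2}-w^k\|^2+D_3.$$ Let $T>0$ and $V_k=\tau\|z^k-z^*\|^2+\|w^k-z^*\|^2+T\gamma^2\sigma_k^2$. Then for every $K\ge 1$: (i) in the strongly monotone/strongly convex case, if $\gamma\le\min\left\{\frac{\sqrt{1-\tau}}{2\sqrt{2A+TC}};\frac{1-\tau}{4(\mu_F+\mu_h)}\right\}$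 and $T\ge\frac{4B}{\rho}$, then $$\mathbb{E}[V_K]\le\max\left\{\left(1-\gamma\cdot\frac{\mu_F+\mu_h}{16}\right)^{K-1};\left(1-\frac{\rho}{2}\right)^{K-1}\right\}V_0+\frac{\gamma^2(2D_1+TD_2)}{\min\left\{\gamma\cdot\frac{\mu_F+\mu_h}{16};\frac{\rho}{2}\right\}};$$ (ii) in the monotone/convex case, if $\gamma\le\frac{\sqrt{1-\tau}}{2\sqrt{2A+TC+E}}$ and $T\ge\frac{2B}{\rho}$, then $$\mathbb{E}[\mathrm{Gap}(\hat z^K)]\le\frac{8\max_{u\in\mathcal C}\|z^0-u\|^2+4\gamma^2T\sigma_0^2}{\gamma K}+\gamma(7D_1+3TD_2+D_3),\qquad \hat z^K=\frac1K\sum_{k=0}^{K-1}z^{k+1/2}.$$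
   Context: $\|\cdot\|$ is the Euclidean norm on $\mathbb{R}^d$, $\mathbb{E}$ is expectation. $h:\mathbb{R}^d\to\mathbb{R}\cup\{+\infty\}$ is proper, lower semicontinuous, convex; $F:\mathbb{R}^d\to\mathbb{R}^d$ is an operator; $\mathcal Z\subseteq\mathbb{R}^d$ is nonempty, closed, convex, and $\mathrm{dom}\,h\subseteq\mathcal Z$. $z^*\in\mathcal Z$ is a solution of the variational inequality $\langle F(z^* ),z-z^*\rangle+h(z)-h(z^* )\ge0$ for all $z\in\mathcal Z$. $\mathrm{prox}_{\gamma h}(z)=\arg\min_x\{\gamma h(x)+\frac12\|z-x\|^2\}$. Strongly monotone/strongly convex case: there are $\mu_F,\mu_h\ge0$ with $\mu_F+\mu_h>0$ such that for all $z_1,z_2\in\mathcal Z$: $\langle F(z_1)-F(z_2),z_1-z_2\rangle\ge\mu_F\|z_1-z_2\|^2$ and $h(z_1)-h(z_2)-\langle\nabla h(z_2),z_1-z_2\rangle\ge\frac{\mu_h}{2}\|z_1-z_2\|^2$ ($\nabla h$ denotes a subgradient). Monotone/convex case: the same two inequalities hold with $\mu_F=\mu_h=0$. $\mathrm{Gap}(z)=\max_{u\in\mathcal C}[\langle F(u),z-u\rangle+h(z)-h(u)]$, where $\mathcal C$ is a compact subset of $\mathcal Z$ containing the solution $z^*$. The starting point $z^0=w^0$ and $\sigma_0$ are deterministic. The random choice defining $w^{k+1}$ is made independently of everything generated before it. Bounds of the form $1/0$ are read as $+\infty$.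
   Formalization: In (ii), E[g^{k+1/2} | ·] = F(z^{k+1/2}) is also required conditionally on all earlier g^j (j ≤ k), g^{j+1/2} and random choices (j < k), not only on z^{k+1/2}; with the literal conditioning (ii) is false, e.g. for a rotation F in the plane with correlated noise. *)

theory Defs
  imports "HOL-Probability.Probability"
begin

section \<open>Extended-valued convex functions and the proximal operator\<close>

definition domain_of :: "('n \<Rightarrow> ereal) \<Rightarrow> 'n set" where
  "domain_of h = {x. h x < \<infinity>}"

definition proper_fun :: "('n \<Rightarrow> ereal) \<Rightarrow> bool" where
  "proper_fun h \<longleftrightarrow> (\<forall>x. h x \<noteq> -\<infinity>) \<and> (\<exists>x. h x < \<infinity>)"

definition lsc_fun :: "('n::topological_space \<Rightarrow> ereal) \<Rightarrow> bool" where
  "lsc_fun h \<longleftrightarrow> (\<forall>x. h x \<le> Liminf (at x) h)"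

definition convex_fun :: "('n::real_vector \<Rightarrow> ereal) \<Rightarrow> bool" where
  "convex_fun h \<longleftrightarrow>
     (\<forall>x y u v. 0 \<le> u \<and> 0 \<le> v \<and> u + v = 1 \<longrightarrow>
        h (u *\<^sub>R x + v *\<^sub>R y) \<le> ereal u * h x + ereal v * h y)"

definition subdifferential :: "('n::real_inner \<Rightarrow> ereal) \<Rightarrow> 'n \<Rightarrow> 'n set" where
  "subdifferential h x = {s. \<bar>h x\<bar> \<noteq> \<infinity> \<and> (\<forall>y. h x + ereal (s \<bullet> (y - x)) \<le> h y)}"

text \<open>
  The inequality is required for every subgradient at every point of \<open>Z\<close> that has one; it is void
  at points (for instance outside the domain) where the subdifferential is empty.
\<close>

definition strongly_convex_on :: "'n::real_inner set \<Rightarrow> ('n \<Rightarrow> ereal) \<Rightarrow> real \<Rightarrow> bool" where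
  "strongly_convex_on Z h \<mu> \<longleftrightarrow>
     (\<forall>z1\<in>Z. \<forall>z2\<in>Z. \<forall>s\<in>subdifferential h z2.
        h z1 - h z2 - ereal (s \<bullet> (z1 - z2)) \<ge> ereal (\<mu> / 2 * (norm (z1 - z2))\<^sup>2))"

definition strongly_monotone_on :: "'n::real_inner set \<Rightarrow> ('n \<Rightarrow> 'n) \<Rightarrow> real \<Rightarrow> bool" where
  "strongly_monotone_on Z F \<mu> \<longleftrightarrow>
     (\<forall>z1\<in>Z. \<forall>z2\<in>Z. (F z1 - F z2) \<bullet> (z1 - z2) \<ge> \<mu> * (norm (z1 - z2))\<^sup>2)"

definition prox :: "real \<Rightarrow> ('n::real_normed_vector \<Rightarrow> ereal) \<Rightarrow> 'n \<Rightarrow> 'n" where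
  "prox \<gamma> h z =
     arg_min (\<lambda>x. ereal \<gamma> * h x + ereal (1 / 2 * (norm (z - x))\<^sup>2)) (\<lambda>x. True)"

definition vi_solution :: "'n::real_inner set \<Rightarrow> ('n \<Rightarrow> 'n) \<Rightarrow> ('n \<Rightarrow> ereal) \<Rightarrow> 'n \<Rightarrow> bool" where
  "vi_solution Z F h zs \<longleftrightarrow>
     zs \<in> Z \<and> (\<forall>z\<in>Z. ereal (F zs \<bullet> (z - zs)) + h z - h zs \<ge> 0)"

text \<open>
  The maximum is written as a supremum, since \<open>F\<close> is not assumed continuous and the maximum need
  not be attained. On the domain of \<open>h\<close> the gap is nonnegative as soon as \<open>U\<close> contains a solution and
  \<open>domain_of h \<subseteq> Z\<close>, so mapping it to \<open>ennreal\<close> and taking the nonnegative integral loses nothing.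
\<close>

definition gap :: "'n::real_inner set \<Rightarrow> ('n \<Rightarrow> 'n) \<Rightarrow> ('n \<Rightarrow> ereal) \<Rightarrow> 'n \<Rightarrow> ereal" where
  "gap U F h z = (SUP u\<in>U. ereal (F u \<bullet> (z - u)) + h z - h u)"

definition lyapunov ::
  "real \<Rightarrow> real \<Rightarrow> real \<Rightarrow> 'n::real_normed_vector \<Rightarrow> 'n \<Rightarrow> 'n \<Rightarrow> real \<Rightarrow> real" where
  "lyapunov \<tau> T \<gamma> zs z w s = \<tau> * (norm (z - zs))\<^sup>2 + (norm (w - zs))\<^sup>2 + T * \<gamma>\<^sup>2 * s\<^sup>2"

section \<open>Conditioning\<close>

text \<open>The library has only the real-valued conditional expectation; vectors are treated by coordinates.\<close>

definition vec_cond_exp ::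
  "'w measure \<Rightarrow> 'w measure \<Rightarrow> ('w \<Rightarrow> 'n::euclidean_space) \<Rightarrow> 'w \<Rightarrow> 'n" where
  "vec_cond_exp M G X \<omega> = (\<Sum>i\<in>Basis. real_cond_exp M G (\<lambda>\<omega>. X \<omega> \<bullet> i) \<omega> *\<^sub>R i)"

definition preimages :: "'w measure \<Rightarrow> ('w \<Rightarrow> 'n::topological_space) \<Rightarrow> 'w set set" where
  "preimages M X = {X -` S \<inter> space M | S. S \<in> sets borel}"

text \<open>
  \<open>g k\<close> and \<open>gh k\<close> are the estimators with index \<open>k\<close> and \<open>k + 1/2\<close>, and \<open>R k\<close> is the event that
  \<open>w (Suc k)\<close> is refreshed to \<open>z (Suc k)\<close>. The starting point is deterministic, so the iterates
  themselves need not be listed: \<open>history_half k\<close> is what is known when \<open>z\<close> with index \<open>k + 1/2\<close>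
  has been computed, \<open>history_full k\<close> what is known just before the choice \<open>R k\<close> is made.

  Bounding the expectation of a maximum over \<open>u\<close> needs the noise terms of different steps to be
  uncorrelated. Conditioning on the value of the single iterate with index \<open>k + 1/2\<close> does not give
  this; conditioning on \<open>history_half k\<close> does.
\<close>

definition history_half ::
  "'w measure \<Rightarrow> (nat \<Rightarrow> 'w \<Rightarrow> 'n::topological_space) \<Rightarrow> (nat \<Rightarrow> 'w \<Rightarrow> 'n) \<Rightarrow> (nat \<Rightarrow> 'w set)
    \<Rightarrow> nat \<Rightarrow> 'w measure" where
  "history_half M g gh R k =
     sigma (space M)
       ((\<Union>j\<in>{..k}. preimages M (g j)) \<union> (\<Union>j\<in>{..<k}. preimages M (gh j)) \<union> R ` {..<k})"

definition history_full ::
  "'w measure \<Rightarrow> (nat \<Rightarrow> 'w \<Rightarrow> 'n::topological_space) \<Rightarrow> (nat \<Rightarrow> 'w \<Rightarrow> 'n) \<Rightarrow> (nat \<Rightarrow> 'w \<Rightarrow> real)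
    \<Rightarrow> (nat \<Rightarrow> 'w set) \<Rightarrow> nat \<Rightarrow> 'w measure" where
  "history_full M g gh \<sigma> R k =
     sigma (space M)
       ((\<Union>j\<in>{..k}. preimages M (g j) \<union> preimages M (gh j) \<union> preimages M (\<sigma> j)) \<union> R ` {..<k})"

end

theory Submission
  imports Defs
begin

text \<open>
  Adding the two proximal inequalities gives a pathwise descent inequality for the distance of
  \<open>z\<close> with index \<open>k + 1\<close> to any \<open>u\<close> in the domain of \<open>h\<close>, with the negative terms
  \<open>\<tau> |z - z'|\<^sup>2\<close> and \<open>(1 - \<tau>) |z' - w|\<^sup>2\<close>, where \<open>z'\<close> is the half iterate. Averaging over the
  choice of \<open>w\<close> turns it into a descent of \<open>\<tau> |z - u|\<^sup>2 + |w - u|\<^sup>2\<close>.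

  In the strongly monotone case take \<open>u\<close> to be the solution: the noise has mean zero, the step size
  lets the negative terms pay for the variance, and \<open>|z - u|\<^sup>2\<close>, \<open>|w - u|\<^sup>2\<close> are controlled by
  \<open>|z' - u|\<^sup>2\<close> and the negative terms, so that the Lyapunov function contracts.

  In the monotone case \<open>u\<close> has to stay free until after the maximum. It occurs only linearly, paired with
  the sum of the noise and of the drift of \<open>w\<close> caused by the random choice. Both sums are martingales,
  so Young's inequality separates them from \<open>u - z0\<close> and leaves second moments that add up step by step.
\<close>

section \<open>The proximal operator\<close>

text \<open>The potential has weight \<tau> on \<open>z\<close> and weight 1 on \<open>w\<close>
  because the pathwise inequality returns only \<open>(1 - \<tau>) |w - u|^2\<close>; the missing
  \<open>\<tau> |w - u|^2\<close> comes from the event that \<open>w\<close> is kept, and the new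
  \<open>|z - u|^2\<close> splits into a share \<tau> for \<open>z\<close> and a share
  \<open>1 - \<tau>\<close> for the mean of the new \<open>w\<close>. The obstacle in the monotone
  case is that the maximizing \<open>u\<close> depends on the whole trajectory, so terms that have
  mean zero for each fixed \<open>u\<close> cannot be dropped before the maximum. The two error sums
  are therefore weighted differently in Young's inequality: the variance of the noise is controlled
  by assumption, while that of the drift is a multiple of \<open>|z' - w|^2\<close>, for the next
  iterate \<open>z'\<close>, and has to fit into the negative terms of the descent. The cases also
  differ in conditioning. For \<open>u = zs\<close> the noise meets only a function of the half
  iterate, whereas orthogonality of noise terms from different steps is a statement about the
  history. Square integrability of the iterates is not assumed but recovered from that of the
  increments.\<close>

lemma norm_diff_scaleR_squared:
  fixes x y :: "'a::real_inner"
  shows "(norm (x - t *\<^sub>R y))\<^sup>2 = (norm x)\<^sup>2 - 2 * t * (x \<bullet> y) + t\<^sup>2 * (norm y)\<^sup>2"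
  unfolding power2_norm_eq_inner
  by (simp add: inner_diff_left inner_diff_right inner_commute power2_eq_square algebra_simps)

section \<open>Lower semicontinuity and attained minima\<close>

text \<open>The \<open>Liminf\<close> in \<open>lsc_fun\<close> ignores the value at
  \<open>x\<close>; the strict inequality at \<open>x\<close> itself is what extends the eventual
  bound from \<open>at x\<close> to \<open>nhds x\<close>.\<close>

lemma lsc_fun_open_superlevel:
  assumes "lsc_fun h"
  shows "open {x. y < h x}"
proof (subst open_subopen, intro ballI)
  fix x assume "x \<in> {x. y < h x}"
  then have "y < h x" by simp
  moreover have "h x \<le> Liminf (at x) h"
    using assms by (simp add: lsc_fun_def)
  ultimately have "eventually (\<lambda>u. y < h u) (at x)"
    using le_Liminf_iff by blast
  with \<open>y < h x\<close> have "eventually (\<lambda>u. y < h u) (nhds x)"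
    unfolding eventually_at_filter by (auto elim: eventually_mono)
  then show "\<exists>S. open S \<and> x \<in> S \<and> S \<subseteq> {x. y < h x}"
    by (auto simp: eventually_nhds)
qed

lemma ereal_less_mult_add_iff:
  assumes "0 < \<gamma>"
  shows "ereal c < ereal \<gamma> * e + ereal q \<longleftrightarrow> ereal ((c - q) / \<gamma>) < e"
  using assms by (cases e) (auto simp: field_simps)

text \<open>A real \<open>d\<close> strictly between the rescaled threshold and \<open>h x\<close>
  decouples the summands: near \<open>x\<close>, \<open>h\<close> stays above \<open>d\<close> by
  semicontinuity and the threshold stays below \<open>d\<close> by continuity of
  \<open>q\<close>.\<close>

lemma lsc_fun_add_continuous_open_superlevel:
  fixes h :: "'a::topological_space \<Rightarrow> ereal"
  assumes "lsc_fun h" "0 < \<gamma>" "continuous_on UNIV q"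
  shows "open {x. ereal c < ereal \<gamma> * h x + ereal (q x)}"
proof (subst open_subopen, intro ballI)
  fix x assume "x \<in> {x. ereal c < ereal \<gamma> * h x + ereal (q x)}"
  then have "ereal ((c - q x) / \<gamma>) < h x"
    using assms(2) by (simp add: ereal_less_mult_add_iff)
  then obtain d where d: "ereal ((c - q x) / \<gamma>) < ereal d" "ereal d < h x"
    using ereal_dense2 by blast
  have "open {y. (c - q y) / \<gamma> < d}"
    using assms(2,3) by (intro open_Collect_less continuous_intros) auto
  then have "open ({y. ereal d < h y} \<inter> {y. (c - q y) / \<gamma> < d})"
    using lsc_fun_open_superlevel[OF assms(1)] by blast
  moreover have "{y. ereal d < h y} \<inter> {y. (c - q y) / \<gamma> < d} \<subseteq> {x. ereal c < ereal \<gamma> * h x + ereal (q x)}"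
    using assms(2) by (auto simp: ereal_less_mult_add_iff less_trans[of "ereal _" "ereal d"])
  ultimately show "\<exists>S. open S \<and> x \<in> S \<and> S \<subseteq> {x. ereal c < ereal \<gamma> * h x + ereal (q x)}"
    using d by (intro exI[of _ "{y. ereal d < h y} \<inter> {y. (c - q y) / \<gamma> < d}"]) auto
qed

text \<open>If no point were minimal, the superlevel sets at levels above some value of
  \<open>f\<close> on \<open>S\<close> would cover \<open>S\<close>. In a finite subcover some
  \<open>y\<close> has value below the least level \<open>Min C\<close>, yet \<open>y\<close> must
  exceed one of the levels.\<close>

lemma compact_attains_inf_lsc:
  fixes f :: "'a::topological_space \<Rightarrow> ereal"
  assumes "compact S" "S \<noteq> {}" and op: "\<And>c. open {x. ereal c < f x}"
  obtains x where "x \<in> S" "\<And>y. y \<in> S \<Longrightarrow> f x \<le> f y"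
proof (rule ccontr)
  assume "\<not> thesis"
  with that have "\<forall>x\<in>S. \<exists>y\<in>S. f y < f x"
    by (meson not_le)
  then have cover: "S \<subseteq> (\<Union>c\<in>{c. \<exists>y\<in>S. f y < ereal c}. {x. ereal c < f x})"
    using ereal_dense2 by fastforce
  obtain C where C: "C \<subseteq> {c. \<exists>y\<in>S. f y < ereal c}" "finite C" "S \<subseteq> (\<Union>c\<in>C. {x. ereal c < f x})"
    by (rule compactE_image[OF assms(1) _ cover]) (rule op)
  with assms(2) have "C \<noteq> {}" by auto
  with C obtain y where y: "y \<in> S" "f y < ereal (Min C)"
    using Min_in by blast
  with C obtain c where "c \<in> C" "ereal c < f y" by blast
  with C y have "ereal (Min C) < ereal (Min C)"
    by (meson Min_le ereal_less_eq(3) le_less_trans less_trans)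
  then show False by simp
qed

lemma lsc_fun_compact_attains_inf:
  assumes "lsc_fun h" "compact S" "S \<noteq> {}"
  obtains x where "x \<in> S" "\<And>y. y \<in> S \<Longrightarrow> h x \<le> h y"
  using compact_attains_inf_lsc[OF assms(2,3)] lsc_fun_open_superlevel[OF assms(1)] by blast

text \<open>
  Linear lower growth replaces an affine minorant, hence the Hahn-Banach theorem: convexity along the
  ray from \<open>x0\<close> transports the minimum of \<open>h\<close> over the unit ball outwards.
\<close>

lemma convex_fun_linear_growth:
  fixes h :: "'a::euclidean_space \<Rightarrow> ereal"
  assumes "proper_fun h" "lsc_fun h" "convex_fun h" "h x0 = ereal a"
  obtains L where "0 \<le> L" "\<And>x. 1 \<le> dist x0 x \<Longrightarrow> ereal (a - L * dist x0 x) \<le> h x"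
proof -
  obtain y0 where y0: "y0 \<in> cball x0 1" "\<And>y. y \<in> cball x0 1 \<Longrightarrow> h y0 \<le> h y"
    using lsc_fun_compact_attains_inf[OF assms(2), of "cball x0 1"] by auto
  have "h y0 \<le> ereal a" using y0(2)[of x0] assms(4) by simp
  moreover have "h y0 \<noteq> -\<infinity>" using assms(1) by (simp add: proper_fun_def)
  ultimately obtain m where m: "h y0 = ereal m" "m \<le> a" by (cases "h y0") auto
  show thesis
  proof (rule that[of "a - m"])
    fix x assume r: "1 \<le> dist x0 x"
    define r where "r = dist x0 x"
    define y where "y = (1 - 1 / r) *\<^sub>R x0 + (1 / r) *\<^sub>R x"
    have r1: "1 \<le> r" using r by (simp add: r_def)
    have "y - x0 = (1 / r) *\<^sub>R (x - x0)"
      by (simp add: y_def algebra_simps)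
    then have "norm (y - x0) = (1 / r) * norm (x - x0)"
      using r1 by simp
    then have "dist x0 y = 1"
      using r1 by (auto simp: dist_norm norm_minus_commute r_def)
    then have "ereal m \<le> h y"
      using y0(2)[of y] m by simp
    also have "h y \<le> ereal (1 - 1 / r) * h x0 + ereal (1 / r) * h x"
      using assms(3)[unfolded convex_fun_def, rule_format, of "1 - 1 / r" "1 / r" x0 x] r1
      unfolding y_def by simp
    finally have *: "ereal m \<le> ereal (1 - 1 / r) * ereal a + ereal (1 / r) * h x"
      by (simp add: assms(4))
    have "h x \<noteq> -\<infinity>" using assms(1) by (simp add: proper_fun_def)
    then show "ereal (a - (a - m) * dist x0 x) \<le> h x"
    proof (cases "h x")
      case (real b)
      with * have "m \<le> (1 - 1 / r) * a + (1 / r) * b" by simp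
      then have "r * m \<le> r * ((1 - 1 / r) * a + (1 / r) * b)"
        using r1 by (intro mult_left_mono) auto
      also have "\<dots> = (r - 1) * a + b" using r1 by (simp add: field_simps)
      finally show ?thesis using real by (simp add: r_def algebra_simps)
    qed auto
  qed (use m in auto)
qed

section \<open>Existence and optimality of the proximal point\<close>

text \<open>Since \<open>prox\<close> is defined by choice, some minimizer has to be exhibited.
  Compactness gives one on a large ball around \<open>x0\<close>; outside the ball the quadratic
  term outweighs the linear loss allowed by \<open>convex_fun_linear_growth\<close>, so
  \<open>x0\<close> already does at least as well.\<close>

lemma prox_minimizes:
  fixes h :: "'a::euclidean_space \<Rightarrow> ereal"
  assumes "proper_fun h" "lsc_fun h" "convex_fun h" "0 < \<gamma>"
  shows "ereal \<gamma> * h (prox \<gamma> h v) + ereal (1 / 2 * (norm (v - prox \<gamma> h v))\<^sup>2)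
           \<le> ereal \<gamma> * h u + ereal (1 / 2 * (norm (v - u))\<^sup>2)"
proof -
  define f where "f = (\<lambda>x. ereal \<gamma> * h x + ereal (1 / 2 * (norm (v - x))\<^sup>2))"
  obtain x0 where "h x0 < \<infinity>" "h x0 \<noteq> -\<infinity>"
    using assms(1) by (auto simp: proper_fun_def)
  then obtain a where a: "h x0 = ereal a" by (cases "h x0") auto
  obtain L where L: "0 \<le> L" "\<And>x. 1 \<le> dist x0 x \<Longrightarrow> ereal (a - L * dist x0 x) \<le> h x"
    using convex_fun_linear_growth[OF assms(1-3) a] by blast
  define D where "D = norm (v - x0)"
  \<comment> \<open>At distance \<open>s\<close> from \<open>x0\<close> the comparison needs
    \<open>1/2 (s - D)^2 - 1/2 D^2 \<ge> \<gamma> L s\<close>, that is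
    \<open>s \<ge> 2 (\<gamma> L + D)\<close>. The added 1 keeps the radius at least 1, where the
    growth bound becomes available.\<close>
  define r where "r = 2 * (\<gamma> * L + D) + 1"
  have r: "1 \<le> r" using L assms(4) by (simp add: r_def D_def)
  have "open {x. ereal c < f x}" for c
    unfolding f_def using assms
    by (intro lsc_fun_add_continuous_open_superlevel continuous_intros) auto
  then obtain p where p: "p \<in> cball x0 r" "\<And>y. y \<in> cball x0 r \<Longrightarrow> f p \<le> f y"
    using compact_attains_inf_lsc[of "cball x0 r" f] r by auto
  have far: "f x0 \<le> f x" if "x \<notin> cball x0 r" for x
  proof -
    define s where "s = dist x0 x"
    have s: "r < s" using that by (simp add: s_def)
    then have s1: "1 \<le> dist x0 x" using r by (simp add: s_def)
    have "s \<le> D + norm (v - x)"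
      unfolding s_def D_def by (metis dist_norm dist_triangle dist_commute)
    moreover have "D \<le> s"
      using s r_def L assms(4) by (simp add: D_def) (smt (verit) mult_nonneg_nonneg norm_ge_zero)
    ultimately have "(s - D)\<^sup>2 \<le> (norm (v - x))\<^sup>2"
      by (intro power_mono) auto
    moreover have "s * (2 * (\<gamma> * L + D)) \<le> s * s"
      using s r r_def by (intro mult_left_mono) auto
    ultimately have "\<gamma> * a + 1 / 2 * D\<^sup>2 \<le> \<gamma> * (a - L * s) + 1 / 2 * (norm (v - x))\<^sup>2"
      by (simp add: power2_eq_square algebra_simps)
    then have "f x0 \<le> ereal \<gamma> * ereal (a - L * s) + ereal (1 / 2 * (norm (v - x))\<^sup>2)"
      by (simp add: f_def a D_def)
    also have "\<dots> \<le> f x"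
      unfolding f_def using L(2)[OF s1] assms(4)
      by (intro add_right_mono ereal_mult_left_mono) (auto simp: s_def)
    finally show ?thesis .
  qed
  have "f p \<le> f y" for y
    using p(2)[of y] p(2)[of x0] far[of y] r by (cases "y \<in> cball x0 r") (auto intro: order_trans)
  then have "is_arg_min f (\<lambda>_. True) p"
    by (simp add: is_arg_min_def not_less)
  then have "is_arg_min f (\<lambda>_. True) (arg_min f (\<lambda>_. True))"
    unfolding arg_min_def by (rule someI)
  then have "f (prox \<gamma> h v) \<le> f u"
    by (simp add: is_arg_min_def not_less prox_def f_def)
  then show ?thesis by (simp add: f_def)
qed

lemma prox_finite:
  fixes h :: "'a::euclidean_space \<Rightarrow> ereal"
  assumes "proper_fun h" "lsc_fun h" "convex_fun h" "0 < \<gamma>"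
  shows "\<bar>h (prox \<gamma> h v)\<bar> \<noteq> \<infinity>"
proof -
  obtain x0 where "h x0 < \<infinity>" "h x0 \<noteq> -\<infinity>"
    using assms(1) by (auto simp: proper_fun_def)
  moreover have "h (prox \<gamma> h v) \<noteq> -\<infinity>"
    using assms(1) by (simp add: proper_fun_def)
  ultimately show ?thesis
    using prox_minimizes[OF assms, of v x0] assms(4)
    by (cases "h x0"; cases "h (prox \<gamma> h v)") auto
qed

lemma nonpos_if_le_small_multiples:
  fixes a b :: real
  assumes "\<And>t. 0 < t \<Longrightarrow> t < 1 \<Longrightarrow> a \<le> t * b"
  shows "a \<le> 0"
proof (rule tendsto_lowerbound)
  show "((\<lambda>t. t * b) \<longlongrightarrow> 0) (at_right 0)"
    by (auto intro!: tendsto_eq_intros)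
  show "eventually (\<lambda>t. a \<le> t * b) (at_right 0)"
    using assms by (auto simp: eventually_at_right_field intro!: exI[of _ 1])
qed simp

text \<open>First-order optimality along the segment from \<open>p\<close> to \<open>y\<close>:
  convexity bounds \<open>h\<close> linearly in \<open>t\<close>, the expanded square leaves an
  error of order \<open>t^2\<close>, and dividing by \<open>t\<close> and letting \<open>t\<close>
  tend to 0 removes it.\<close>

lemma prox_subgradient:
  fixes h :: "'a::euclidean_space \<Rightarrow> ereal"
  assumes "proper_fun h" "lsc_fun h" "convex_fun h" "0 < \<gamma>"
  shows "(1 / \<gamma>) *\<^sub>R (v - prox \<gamma> h v) \<in> subdifferential h (prox \<gamma> h v)"
proof -
  define p where "p = prox \<gamma> h v"
  obtain a where a: "h p = ereal a"
    using prox_finite[OF assms, of v] by (auto simp: p_def)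
  have "h p + ereal (((1 / \<gamma>) *\<^sub>R (v - p)) \<bullet> (y - p)) \<le> h y" for y
  proof (cases "h y")
    case (real b)
    have "(v - p) \<bullet> (y - p) - \<gamma> * (b - a) \<le> t * (1 / 2 * (norm (y - p))\<^sup>2)" if t: "0 < t" "t < 1" for t
    proof -
      define x where "x = (1 - t) *\<^sub>R p + t *\<^sub>R y"
      have "h x \<le> ereal (1 - t) * h p + ereal t * h y"
        using assms(3) t unfolding convex_fun_def x_def by simp
      then have "ereal \<gamma> * h x \<le> ereal \<gamma> * ereal ((1 - t) * a + t * b)"
        using assms(4) by (intro ereal_mult_left_mono) (auto simp: a real)
      then have "ereal \<gamma> * h x + ereal (1 / 2 * (norm (v - x))\<^sup>2) \<le>
          ereal \<gamma> * ereal ((1 - t) * a + t * b) + ereal (1 / 2 * (norm (v - x))\<^sup>2)"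
        by (intro add_right_mono)
      with prox_minimizes[OF assms, of v x]
      have "\<gamma> * a + 1 / 2 * (norm (v - p))\<^sup>2 \<le> \<gamma> * ((1 - t) * a + t * b) + 1 / 2 * (norm (v - x))\<^sup>2"
        by (fold p_def) (auto simp: a dest: order_trans)
      moreover have "v - x = (v - p) - t *\<^sub>R (y - p)"
        by (simp add: x_def algebra_simps)
      then have "(norm (v - x))\<^sup>2 = (norm (v - p))\<^sup>2 - 2 * t * ((v - p) \<bullet> (y - p)) + t\<^sup>2 * (norm (y - p))\<^sup>2"
        by (simp only: norm_diff_scaleR_squared)
      ultimately have "t * ((v - p) \<bullet> (y - p) - \<gamma> * (b - a)) \<le> t * (t * (1 / 2 * (norm (y - p))\<^sup>2))"
        by (simp add: power2_eq_square algebra_simps)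
      then show ?thesis using t by simp
    qed
    then have "(v - p) \<bullet> (y - p) - \<gamma> * (b - a) \<le> 0"
      by (rule nonpos_if_le_small_multiples)
    then have "(v - p) \<bullet> (y - p) / \<gamma> \<le> b - a"
      using assms(4) by (simp add: field_simps)
    then show ?thesis
      by (simp add: a real)
  qed (use assms(1) a in \<open>auto simp: proper_fun_def\<close>)
  then show ?thesis
    unfolding subdifferential_def by (fold p_def) (simp add: a)
qed

lemma prox_variational_inequality:
  fixes h :: "'a::euclidean_space \<Rightarrow> ereal"
  assumes "proper_fun h" "lsc_fun h" "convex_fun h" "0 < \<gamma>" "u \<in> domain_of h"
  shows "(v - prox \<gamma> h v) \<bullet> (u - prox \<gamma> h v)
           \<le> \<gamma> * (real_of_ereal (h u) - real_of_ereal (h (prox \<gamma> h v)))"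
proof -
  obtain a where a: "h (prox \<gamma> h v) = ereal a"
    using prox_finite[OF assms(1-4), of v] by auto
  obtain b where b: "h u = ereal b"
    using assms(1,5) by (cases "h u") (auto simp: proper_fun_def domain_of_def)
  show ?thesis
    using prox_subgradient[OF assms(1-4), of v] assms(4)
    unfolding subdifferential_def by (auto simp: a dest!: spec[of _ u]) (auto simp: b field_simps)
qed

lemma prox_in_domain:
  fixes h :: "'a::euclidean_space \<Rightarrow> ereal"
  assumes "proper_fun h" "lsc_fun h" "convex_fun h" "0 < \<gamma>"
  shows "prox \<gamma> h v \<in> domain_of h"
  using prox_finite[OF assms, of v] by (auto simp: domain_of_def)

text \<open>Testing the variational inequality of each proximal point at the other one cancels the
  values of \<open>h\<close>, which gives firm nonexpansiveness; Cauchy-Schwarz finishes. Besides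
  measurability of \<open>prox\<close>, this later bounds the distance between the half and the full
  iterate.\<close>

lemma prox_nonexpansive:
  fixes h :: "'a::euclidean_space \<Rightarrow> ereal"
  assumes "proper_fun h" "lsc_fun h" "convex_fun h" "0 < \<gamma>"
  shows "norm (prox \<gamma> h u - prox \<gamma> h v) \<le> norm (u - v)"
proof -
  define p q where "p = prox \<gamma> h u" and "q = prox \<gamma> h v"
  have "(u - p) \<bullet> (q - p) + (v - q) \<bullet> (p - q) \<le> 0"
    using prox_variational_inequality[OF assms prox_in_domain[OF assms], of u v]
      prox_variational_inequality[OF assms prox_in_domain[OF assms], of v u]
    by (simp add: p_def q_def algebra_simps)
  then have "(norm (p - q))\<^sup>2 \<le> (u - v) \<bullet> (p - q)"
    by (simp add: power2_norm_eq_inner inner_diff_left inner_diff_right inner_commute)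
  also have "\<dots> \<le> norm (u - v) * norm (p - q)"
    by (rule norm_cauchy_schwarz)
  finally have "norm (p - q) * norm (p - q) \<le> norm (u - v) * norm (p - q)"
    by (simp add: power2_eq_square)
  then have "norm (p - q) \<le> norm (u - v)"
    using mult_le_cancel_right norm_ge_zero by (smt (verit))
  then show ?thesis by (simp add: p_def q_def)
qed

lemma prox_borel_measurable:
  fixes h :: "'a::euclidean_space \<Rightarrow> ereal"
  assumes "proper_fun h" "lsc_fun h" "convex_fun h" "0 < \<gamma>"
  shows "prox \<gamma> h \<in> borel_measurable borel"
proof (rule borel_measurable_continuous_onI)
  show "continuous_on UNIV (prox \<gamma> h)"
    unfolding continuous_on_iff dist_norm
    by (intro ballI allI impI exI conjI) (assumption, rule le_less_trans[OF prox_nonexpansive[OF assms]])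
qed

section \<open>The pathwise one-step inequality\<close>

text \<open>The half step is tested at \<open>zp\<close> and the full step at \<open>u\<close>, so
  that \<open>h zp\<close> cancels in the sum. Of the resulting \<open>|zp - zh|^2\<close> one half
  pays for the mismatch \<open>gh - g\<close>; the other half is kept, since the drift of
  \<open>w\<close> needs it in the monotone case.\<close>

lemma extragradient_step:
  fixes h :: "'a::euclidean_space \<Rightarrow> ereal"
  assumes h: "proper_fun h" "lsc_fun h" "convex_fun h" "0 < \<gamma>" and u: "u \<in> domain_of h"
    and zh: "zh = prox \<gamma> h ((\<tau> *\<^sub>R z + (1 - \<tau>) *\<^sub>R w) - \<gamma> *\<^sub>R g)"
    and zp: "zp = prox \<gamma> h ((\<tau> *\<^sub>R z + (1 - \<tau>) *\<^sub>R w) - \<gamma> *\<^sub>R gh)"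
  shows "(norm (zp - u))\<^sup>2 + 2 * \<gamma> * (gh \<bullet> (zh - u) + real_of_ereal (h zh) - real_of_ereal (h u))
    \<le> \<tau> * (norm (z - u))\<^sup>2 + (1 - \<tau>) * (norm (w - u))\<^sup>2 - 1 / 2 * (norm (zp - zh))\<^sup>2
      - \<tau> * (norm (z - zh))\<^sup>2 - (1 - \<tau>) * (norm (zh - w))\<^sup>2 + 2 * \<gamma>\<^sup>2 * (norm (gh - g))\<^sup>2"
proof -
  define b where "b = \<tau> *\<^sub>R z + (1 - \<tau>) *\<^sub>R w"
  have "zp \<in> domain_of h" unfolding zp by (rule prox_in_domain[OF h])
  then have 1: "(b - \<gamma> *\<^sub>R g - zh) \<bullet> (zp - zh) \<le> \<gamma> * (real_of_ereal (h zp) - real_of_ereal (h zh))"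
    unfolding zh b_def by (rule prox_variational_inequality[OF h])
  have 2: "(b - \<gamma> *\<^sub>R gh - zp) \<bullet> (u - zp) \<le> \<gamma> * (real_of_ereal (h u) - real_of_ereal (h zp))"
    unfolding zp b_def by (rule prox_variational_inequality[OF h u])
  \<comment> \<open>Half of \<open>0 \<le> |(zp - zh) + 2 \<gamma> (gh - g)|^2\<close>.\<close>
  have 3: "- (2 * \<gamma> * ((gh - g) \<bullet> (zp - zh))) \<le> 2 * \<gamma>\<^sup>2 * (norm (gh - g))\<^sup>2 + 1 / 2 * (norm (zp - zh))\<^sup>2"
    using zero_le_power2[of "norm ((zp - zh) - (- (2 * \<gamma>)) *\<^sub>R (gh - g))"]
    unfolding norm_diff_scaleR_squared
    by (simp add: inner_commute power2_eq_square algebra_simps)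
  \<comment> \<open>The inner product is linear in \<open>b\<close>, so polarizing each part
    separately splits it with weights \<tau> and \<open>1 - \<tau>\<close> and produces no term in
    \<open>|z - w|^2\<close>.\<close>
  have polar: "2 * ((b - p) \<bullet> (x - p)) = \<tau> * ((norm (z - p))\<^sup>2 + (norm (x - p))\<^sup>2 - (norm (z - x))\<^sup>2)
      + (1 - \<tau>) * ((norm (w - p))\<^sup>2 + (norm (x - p))\<^sup>2 - (norm (w - x))\<^sup>2)" for p x
  proof -
    have *: "(norm (y - p))\<^sup>2 + (norm (x - p))\<^sup>2 - (norm (y - x))\<^sup>2 = 2 * ((y - p) \<bullet> (x - p))" for y
      by (simp add: power2_norm_eq_inner inner_diff_left inner_diff_right inner_commute)
    have "b - p = \<tau> *\<^sub>R (z - p) + (1 - \<tau>) *\<^sub>R (w - p)"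
      by (simp add: b_def algebra_simps)
    then have "(b - p) \<bullet> (x - p) = \<tau> * ((z - p) \<bullet> (x - p)) + (1 - \<tau>) * ((w - p) \<bullet> (x - p))"
      by (simp only: inner_add_left inner_scaleR_left)
    then show ?thesis unfolding * by (simp add: algebra_simps)
  qed
  have 4: "2 * ((b - zp) \<bullet> (u - zp)) + 2 * ((b - zh) \<bullet> (zp - zh)) =
      (norm (zp - u))\<^sup>2 - \<tau> * (norm (z - u))\<^sup>2 - (1 - \<tau>) * (norm (w - u))\<^sup>2 + (norm (zp - zh))\<^sup>2
      + \<tau> * (norm (z - zh))\<^sup>2 + (1 - \<tau>) * (norm (zh - w))\<^sup>2"
    unfolding polar by (simp add: norm_minus_commute algebra_simps)
  have 5: "(b - \<gamma> *\<^sub>R gh - zp) \<bullet> (u - zp) + (b - \<gamma> *\<^sub>R g - zh) \<bullet> (zp - zh) =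
     (b - zp) \<bullet> (u - zp) + (b - zh) \<bullet> (zp - zh) + \<gamma> * (gh \<bullet> (zh - u)) + \<gamma> * ((gh - g) \<bullet> (zp - zh))"
    by (simp add: inner_diff_left inner_diff_right algebra_simps)
  show ?thesis
    using 1 2 3 4 5 by (simp add: algebra_simps)
qed

section \<open>Square-integrable random vectors\<close>

definition square_integrable :: "'w measure \<Rightarrow> ('w \<Rightarrow> 'n::euclidean_space) \<Rightarrow> bool" where
  "square_integrable M X \<longleftrightarrow> X \<in> borel_measurable M \<and> integrable M (\<lambda>\<omega>. (norm (X \<omega>))\<^sup>2)"

lemma square_integrable_measurable [measurable_dest]:
  "square_integrable M X \<Longrightarrow> X \<in> borel_measurable M"
  by (simp add: square_integrable_def)

lemma square_integrable_norm [intro]: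
  "square_integrable M X \<Longrightarrow> integrable M (\<lambda>\<omega>. (norm (X \<omega>))\<^sup>2)"
  by (simp add: square_integrable_def)

lemma square_integrable_bound:
  assumes "square_integrable M X" "Y \<in> borel_measurable M"
    and "\<And>\<omega>. \<omega> \<in> space M \<Longrightarrow> norm (Y \<omega>) \<le> c * norm (X \<omega>)"
  shows "square_integrable M Y"
proof -
  have "(norm (Y \<omega>))\<^sup>2 \<le> c\<^sup>2 * (norm (X \<omega>))\<^sup>2" if "\<omega> \<in> space M" for \<omega>
    using power_mono[OF assms(3)[OF that], of 2] by (simp add: power_mult_distrib)
  moreover have "integrable M (\<lambda>\<omega>. c\<^sup>2 * (norm (X \<omega>))\<^sup>2)"
    using assms(1) by (simp add: square_integrable_def)
  ultimately have "integrable M (\<lambda>\<omega>. (norm (Y \<omega>))\<^sup>2)"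
    using assms(2) by (elim Bochner_Integration.integrable_bound) (simp_all add: AE_I2)
  then show ?thesis using assms(2) by (simp add: square_integrable_def)
qed

lemma norm_add_power2_le:
  fixes x y :: "'a::real_inner"
  shows "(norm (x + y))\<^sup>2 \<le> 2 * (norm x)\<^sup>2 + 2 * (norm y)\<^sup>2"
proof -
  have "0 \<le> (norm (x - y))\<^sup>2" by simp
  then show ?thesis
    unfolding power2_norm_eq_inner by (simp add: inner_add_left inner_add_right inner_diff_left inner_diff_right inner_commute)
qed

lemma norm_diff_power2_le:
  fixes x y u :: "'a::real_inner"
  shows "(norm (x - u))\<^sup>2 \<le> 2 * (norm (x - y))\<^sup>2 + 2 * (norm (y - u))\<^sup>2"
  using norm_add_power2_le[of "x - y" "y - u"] by simp

lemma square_integrable_add [intro]: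
  assumes "square_integrable M X" "square_integrable M Y"
  shows "square_integrable M (\<lambda>\<omega>. X \<omega> + Y \<omega>)"
proof -
  have [measurable]: "X \<in> borel_measurable M" "Y \<in> borel_measurable M"
    using assms by (simp_all add: square_integrable_def)
  have "integrable M (\<lambda>\<omega>. 2 * (norm (X \<omega>))\<^sup>2 + 2 * (norm (Y \<omega>))\<^sup>2)"
    using assms by (simp add: square_integrable_def)
  then have "integrable M (\<lambda>\<omega>. (norm (X \<omega> + Y \<omega>))\<^sup>2)"
    by (rule Bochner_Integration.integrable_bound) (simp_all add: norm_add_power2_le)
  then show ?thesis by (simp add: square_integrable_def)
qed

lemma square_integrable_uminus [intro]:
  "square_integrable M X \<Longrightarrow> square_integrable M (\<lambda>\<omega>. - X \<omega>)"
  by (auto simp: square_integrable_def)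

lemma square_integrable_diff [intro]:
  "square_integrable M X \<Longrightarrow> square_integrable M Y \<Longrightarrow> square_integrable M (\<lambda>\<omega>. X \<omega> - Y \<omega>)"
  using square_integrable_add[of M X "\<lambda>\<omega>. - Y \<omega>"] by auto

lemma (in finite_measure) square_integrable_const [intro]: "square_integrable M (\<lambda>_. c)"
  by (simp add: square_integrable_def)

lemma square_integrable_sum:
  "(\<And>k. square_integrable M (X k)) \<Longrightarrow> square_integrable M (\<lambda>\<omega>. \<Sum>k<(n::nat). X k \<omega>)"
  by (induction n) (auto simp: square_integrable_def[of _ "\<lambda>_. 0"])

lemma square_integrable_inner [intro]:
  fixes X Y :: "'w \<Rightarrow> 'n::euclidean_space"
  assumes "square_integrable M X" "square_integrable M Y"
  shows "integrable M (\<lambda>\<omega>. X \<omega> \<bullet> Y \<omega>)"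
proof -
  have [measurable]: "X \<in> borel_measurable M" "Y \<in> borel_measurable M"
    using assms by (simp_all add: square_integrable_def)
  have bound: "\<bar>x \<bullet> y\<bar> \<le> (norm x)\<^sup>2 + (norm y)\<^sup>2" for x y :: 'n
    using Cauchy_Schwarz_ineq2[of x y] sum_squares_bound[of "norm x" "norm y"]
      mult_nonneg_nonneg[OF norm_ge_zero[of x] norm_ge_zero[of y]] by linarith
  have "integrable M (\<lambda>\<omega>. (norm (X \<omega>))\<^sup>2 + (norm (Y \<omega>))\<^sup>2)"
    using assms by (simp add: square_integrable_def)
  then show ?thesis
    by (rule Bochner_Integration.integrable_bound) (simp_all add: bound)
qed

lemma square_integrable_orthogonal_sum:
  fixes X :: "nat \<Rightarrow> 'w \<Rightarrow> 'n::euclidean_space"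
  assumes "\<And>k. square_integrable M (X k)"
    and "\<And>j k. j < k \<Longrightarrow> (\<integral>\<omega>. X j \<omega> \<bullet> X k \<omega> \<partial>M) = 0"
  shows "(\<integral>\<omega>. (norm (\<Sum>k<n. X k \<omega>))\<^sup>2 \<partial>M) = (\<Sum>k<n. \<integral>\<omega>. (norm (X k \<omega>))\<^sup>2 \<partial>M)"
proof (induction n)
  case (Suc n)
  let ?S = "\<lambda>\<omega>. \<Sum>k<n. X k \<omega>"
  have S: "square_integrable M ?S" by (rule square_integrable_sum[OF assms(1)])
  have int: "integrable M (\<lambda>\<omega>. X k \<omega> \<bullet> X n \<omega>)" for k
    using assms(1) by auto
  have "(\<integral>\<omega>. ?S \<omega> \<bullet> X n \<omega> \<partial>M) = (\<Sum>k<n. \<integral>\<omega>. X k \<omega> \<bullet> X n \<omega> \<partial>M)"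
    unfolding inner_sum_left by (rule Bochner_Integration.integral_sum) (rule int)
  also have "\<dots> = 0" using assms(2) by simp
  finally have 0: "(\<integral>\<omega>. ?S \<omega> \<bullet> X n \<omega> \<partial>M) = 0" .
  have "(norm (\<Sum>k<Suc n. X k \<omega>))\<^sup>2 = (norm (?S \<omega>))\<^sup>2 + 2 * (?S \<omega> \<bullet> X n \<omega>) + (norm (X n \<omega>))\<^sup>2" for \<omega>
    unfolding power2_norm_eq_inner by (simp add: inner_add_left inner_add_right inner_commute)
  moreover have "integrable M (\<lambda>\<omega>. (norm (?S \<omega>))\<^sup>2)" "integrable M (\<lambda>\<omega>. ?S \<omega> \<bullet> X n \<omega>)"
     "integrable M (\<lambda>\<omega>. (norm (X n \<omega>))\<^sup>2)"
    using S assms(1) by auto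
  ultimately show ?case using 0 Suc by simp
qed simp

section \<open>Conditional expectation and independence\<close>

lemma vec_cond_exp_inner:
  "i \<in> Basis \<Longrightarrow> vec_cond_exp M G X \<omega> \<bullet> i = real_cond_exp M G (\<lambda>\<omega>. X \<omega> \<bullet> i) \<omega>"
  unfolding vec_cond_exp_def by (simp add: inner_sum_left_Basis)

lemma vec_cond_exp_borel_measurable: "vec_cond_exp M G X \<in> borel_measurable G"
  unfolding vec_cond_exp_def[abs_def] by measurable

text \<open>In each coordinate the \<open>G\<close>-measurable factor \<open>f\<close> can be pulled
  out of the conditional expectation of the residual, which is zero. Square integrability is asked
  of \<open>f\<close> and of the residual, making their product integrable; \<open>X\<close> itself
  need only be integrable.\<close>

lemma (in prob_space) cond_exp_residual_orthogonal:
  fixes X f :: "'a \<Rightarrow> 'n::euclidean_space"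
  assumes sub: "subalgebra M G" and X: "integrable M X"
    and f: "f \<in> borel_measurable G" "square_integrable M f"
    and N: "square_integrable M (\<lambda>\<omega>. X \<omega> - vec_cond_exp M G X \<omega>)"
  shows "(\<integral>\<omega>. (X \<omega> - vec_cond_exp M G X \<omega>) \<bullet> f \<omega> \<partial>M) = 0"
proof -
  interpret G: finite_measure_subalgebra M G
    by (rule finite_measure_subalgebra.intro[OF finite_measure_axioms finite_measure_subalgebra_axioms.intro[OF sub]])
  let ?N = "\<lambda>\<omega>. X \<omega> - vec_cond_exp M G X \<omega>"
  have *: "integrable M (\<lambda>\<omega>. (f \<omega> \<bullet> i) * (?N \<omega> \<bullet> i))" "(\<integral>\<omega>. (f \<omega> \<bullet> i) * (?N \<omega> \<bullet> i) \<partial>M) = 0"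
    if i: "i \<in> Basis" for i
  proof -
    have "square_integrable M (\<lambda>\<omega>. Y \<omega> \<bullet> i)" if Y: "square_integrable M Y" for Y :: "'a \<Rightarrow> 'n"
    proof (rule square_integrable_bound[OF Y])
      show "(\<lambda>\<omega>. Y \<omega> \<bullet> i) \<in> borel_measurable M"
        by (intro borel_measurable_inner square_integrable_measurable[OF Y] borel_measurable_const)
      show "norm (Y \<omega> \<bullet> i) \<le> 1 * norm (Y \<omega>)" for \<omega>
        using Basis_le_norm[OF i, of "Y \<omega>"] by simp
    qed
    from square_integrable_inner[OF this[OF f(2)] this[OF N]]
    show int: "integrable M (\<lambda>\<omega>. (f \<omega> \<bullet> i) * (?N \<omega> \<bullet> i))"
      by (simp only: inner_real_def)
    define x where "x = (\<lambda>\<omega>. X \<omega> \<bullet> i)"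
    have x: "integrable M x" unfolding x_def using X by simp
    have Ni: "?N \<omega> \<bullet> i = x \<omega> - real_cond_exp M G x \<omega>" for \<omega>
      using i by (simp add: inner_diff_left vec_cond_exp_inner x_def)
    have rx: "integrable M (real_cond_exp M G x)" by (rule G.real_cond_exp_int[OF x])
    have "AE \<omega> in M. real_cond_exp M G (\<lambda>\<omega>. x \<omega> - real_cond_exp M G x \<omega>) \<omega>
            = real_cond_exp M G x \<omega> - real_cond_exp M G (real_cond_exp M G x) \<omega>"
      by (rule G.real_cond_exp_diff[OF x rx])
    moreover have "AE \<omega> in M. real_cond_exp M G (real_cond_exp M G x) \<omega> = real_cond_exp M G x \<omega>"
      by (rule G.real_cond_exp_F_meas[OF rx]) simp
    ultimately have ae: "AE \<omega> in M. (f \<omega> \<bullet> i) * real_cond_exp M G (\<lambda>\<omega>. x \<omega> - real_cond_exp M G x \<omega>) \<omega> = 0"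
      by eventually_elim simp
    have "(\<integral>\<omega>. (f \<omega> \<bullet> i) * (?N \<omega> \<bullet> i) \<partial>M)
        = (\<integral>\<omega>. (f \<omega> \<bullet> i) * real_cond_exp M G (\<lambda>\<omega>. x \<omega> - real_cond_exp M G x \<omega>) \<omega> \<partial>M)"
      using G.real_cond_exp_intg(2)[of "\<lambda>\<omega>. f \<omega> \<bullet> i" "\<lambda>\<omega>. x \<omega> - real_cond_exp M G x \<omega>"] int f(1) x rx
      unfolding Ni by simp
    also have "\<dots> = 0"
      using ae by (rule integral_eq_zero_AE)
    finally show "(\<integral>\<omega>. (f \<omega> \<bullet> i) * (?N \<omega> \<bullet> i) \<partial>M) = 0" .
  qed
  have "?N \<omega> \<bullet> f \<omega> = (\<Sum>i\<in>Basis. (f \<omega> \<bullet> i) * (?N \<omega> \<bullet> i))" for \<omega>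
    by (subst euclidean_inner) (intro sum.cong refl mult.commute)
  then have "(\<integral>\<omega>. ?N \<omega> \<bullet> f \<omega> \<partial>M) = (\<integral>\<omega>. (\<Sum>i\<in>Basis. (f \<omega> \<bullet> i) * (?N \<omega> \<bullet> i)) \<partial>M)"
    by (simp only:)
  also have "\<dots> = (\<Sum>i\<in>Basis. \<integral>\<omega>. (f \<omega> \<bullet> i) * (?N \<omega> \<bullet> i) \<partial>M)"
    by (intro Bochner_Integration.integral_sum *(1))
  also have "\<dots> = 0"
    by (intro sum.neutral ballI *(2))
  finally show ?thesis .
qed

text \<open>Independence identifies the conditional expectation of \<open>indicator R\<close> given
  \<open>H\<close> as the constant \<open>prob R\<close>, which is then integrated against the
  \<open>H\<close>-measurable \<open>X\<close>.\<close>

lemma (in prob_space) integral_indicator_mult_indep: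
  fixes X :: "'a \<Rightarrow> real"
  assumes sub: "subalgebra M H" and ind: "indep_set {R} (sets H)"
    and R: "R \<in> sets M" and X: "X \<in> borel_measurable H" "integrable M X"
  shows "(\<integral>\<omega>. indicator R \<omega> * X \<omega> \<partial>M) = prob R * (\<integral>\<omega>. X \<omega> \<partial>M)"
proof -
  interpret H: finite_measure_subalgebra M H
    by (rule finite_measure_subalgebra.intro[OF finite_measure_axioms finite_measure_subalgebra_axioms.intro[OF sub]])
  have iR: "integrable M (indicator R :: 'a \<Rightarrow> real)" using R by (simp add: integrable_indicator_iff less_top[symmetric])
  have "AE \<omega> in M. real_cond_exp M H (indicator R) \<omega> = prob R"
  proof (rule H.real_cond_exp_charact)
    fix A assume A: "A \<in> sets H"
    then have A': "A \<in> sets M" using sub by (auto simp: subalgebra_def)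
    have "prob (R \<inter> A) = prob R * prob A"
      by (rule indep_setD[OF ind]) (use A in auto)
    then show "(\<integral>\<omega>\<in>A. indicator R \<omega> \<partial>M) = (\<integral>\<omega>\<in>A. prob R \<partial>M)"
      using A' R by (simp add: set_lebesgue_integral_def indicator_inter_arith[symmetric] Int_commute)
  qed (use iR in auto)
  then have ae: "AE \<omega> in M. X \<omega> * real_cond_exp M H (indicator R) \<omega> = X \<omega> * prob R"
    by eventually_elim simp
  have "integrable M (\<lambda>\<omega>. X \<omega> * indicator R \<omega>)"
    using integrable_mult_indicator[OF R X(2)] by (simp add: mult.commute)
  then have "(\<integral>\<omega>. X \<omega> * indicator R \<omega> \<partial>M) = (\<integral>\<omega>. X \<omega> * real_cond_exp M H (indicator R) \<omega> \<partial>M)"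
    using H.real_cond_exp_intg(2)[of X "indicator R"] X(1) R by simp
  also have "\<dots> = (\<integral>\<omega>. X \<omega> * prob R \<partial>M)"
    using ae X measurable_from_subalg[OF sub X(1)] by (intro integral_cong_AE) auto
  finally show ?thesis by (simp add: mult.commute)
qed

section \<open>The stochastic iteration\<close>

lemma subalgebra_sigma:
  assumes "A \<subseteq> sets M"
  shows "subalgebra M (sigma (space M) A)"
proof -
  have "A \<subseteq> Pow (space M)" using assms sets.space_closed by blast
  then show ?thesis
    using assms by (simp add: subalgebra_def sets.sigma_sets_subset)
qed

lemma borel_measurable_sigma_preimages:
  assumes "A \<subseteq> Pow (space M)" "preimages M X \<subseteq> A"
  shows "X \<in> borel_measurable (sigma (space M) A)"
proof (rule measurableI)
  fix S :: "'b set" assume "S \<in> sets borel"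
  then have "X -` S \<inter> space M \<in> preimages M X" by (auto simp: preimages_def)
  then show "X -` S \<inter> space (sigma (space M) A) \<in> sets (sigma (space M) A)"
    using assms by auto
qed simp

lemma preimages_subset_sets:
  "X \<in> borel_measurable M \<Longrightarrow> preimages M X \<subseteq> sets M"
  by (auto simp: preimages_def measurable_sets)

text \<open>Holds what both cases share: the iteration, the independence of the refresh and the
  integrability assumptions. Unbiasedness stays outside because the two cases condition on different
  sigma-algebras, and the growth constants stay outside because they enter only after
  integration.\<close>

locale stochastic_extragradient = prob_space M
  for M :: "'w measure" +
  fixes h :: "'n::euclidean_space \<Rightarrow> ereal" and F :: "'n \<Rightarrow> 'n" and Z :: "'n set" and zs z0 :: 'n
    and z zh w g gh :: "nat \<Rightarrow> 'w \<Rightarrow> 'n" and \<sigma> :: "nat \<Rightarrow> 'w \<Rightarrow> real" and R :: "nat \<Rightarrow> 'w set"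
    and \<tau> \<gamma> :: real
  assumes h: "proper_fun h" "lsc_fun h" "convex_fun h"
    and domZ: "domain_of h \<subseteq> Z"
    and zs: "vi_solution Z F h zs"
    and tau: "0 \<le> \<tau>" "\<tau> < 1" and gamma: "0 < \<gamma>"
    and g_meas [measurable]: "\<And>k. g k \<in> borel_measurable M"
    and gh_meas [measurable]: "\<And>k. gh k \<in> borel_measurable M"
    and sigma_meas [measurable]: "\<And>k. \<sigma> k \<in> borel_measurable M"
    and R_meas [measurable]: "\<And>k. R k \<in> sets M"
    and z_0: "\<And>\<omega>. \<omega> \<in> space M \<Longrightarrow> z 0 \<omega> = z0"
    and w_0: "\<And>\<omega>. \<omega> \<in> space M \<Longrightarrow> w 0 \<omega> = z0"
    and zh_eq: "\<And>k \<omega>. \<omega> \<in> space M \<Longrightarrow>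
           zh k \<omega> = prox \<gamma> h ((\<tau> *\<^sub>R z k \<omega> + (1 - \<tau>) *\<^sub>R w k \<omega>) - \<gamma> *\<^sub>R g k \<omega>)"
    and z_Suc: "\<And>k \<omega>. \<omega> \<in> space M \<Longrightarrow>
           z (Suc k) \<omega> = prox \<gamma> h ((\<tau> *\<^sub>R z k \<omega> + (1 - \<tau>) *\<^sub>R w k \<omega>) - \<gamma> *\<^sub>R gh k \<omega>)"
    and w_Suc: "\<And>k \<omega>. \<omega> \<in> space M \<Longrightarrow>
           w (Suc k) \<omega> = (if \<omega> \<in> R k then z (Suc k) \<omega> else w k \<omega>)"
    and prob_R: "\<And>k. prob (R k) = 1 - \<tau>"
    and indep_R: "\<And>k. indep_set {R k} (sets (history_full M g gh \<sigma> R k))"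
    and gh_int: "\<And>k. integrable M (gh k)"
    and diff_int: "\<And>k. integrable M (\<lambda>\<omega>. (norm (gh k \<omega> - g k \<omega>))\<^sup>2)"
    and dist_int: "\<And>k. integrable M (\<lambda>\<omega>. (norm (zh k \<omega> - w k \<omega>))\<^sup>2)"
    and noise_int: "\<And>k. integrable M (\<lambda>\<omega>. (norm (gh k \<omega> - F (zh k \<omega>)))\<^sup>2)"
begin

section \<open>Measurability with respect to the histories\<close>

text \<open>Stated for any sigma-algebra \<open>G\<close> on the same space, so that a single
  induction serves \<open>M\<close> and both kinds of history.\<close>

lemma iterates_measurable_from:
  assumes G: "space G = space M" "\<And>j. j < k \<Longrightarrow> gh j \<in> borel_measurable G" "\<And>j. j < k \<Longrightarrow> R j \<in> sets G"
  shows "z k \<in> borel_measurable G" "w k \<in> borel_measurable G"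
proof -
  have "z k \<in> borel_measurable G \<and> w k \<in> borel_measurable G"
    using G(2,3)
  proof (induction k)
    case 0
    have "z 0 \<in> borel_measurable G \<longleftrightarrow> (\<lambda>_. z0) \<in> borel_measurable G"
      "w 0 \<in> borel_measurable G \<longleftrightarrow> (\<lambda>_. z0) \<in> borel_measurable G"
      by (rule measurable_cong; simp add: G(1) z_0 w_0)+
    then show ?case by simp
  next
    case (Suc k)
    then have [measurable]: "z k \<in> borel_measurable G" "w k \<in> borel_measurable G"
      "gh k \<in> borel_measurable G" "R k \<in> sets G" by auto
    have "(\<lambda>\<omega>. prox \<gamma> h ((\<tau> *\<^sub>R z k \<omega> + (1 - \<tau>) *\<^sub>R w k \<omega>) - \<gamma> *\<^sub>R gh k \<omega>)) \<in> borel_measurable G"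
      by (rule measurable_compose[OF _ prox_borel_measurable[OF h gamma]]) measurable
    then have [measurable]: "z (Suc k) \<in> borel_measurable G"
      by (subst measurable_cong[OF z_Suc]) (simp_all add: G(1))
    have "(\<lambda>\<omega>. if \<omega> \<in> R k then z (Suc k) \<omega> else w k \<omega>) \<in> borel_measurable G"
      by measurable
    then have "w (Suc k) \<in> borel_measurable G"
      by (subst measurable_cong[OF w_Suc]) (simp_all add: G(1))
    then show ?case by simp
  qed
  then show "z k \<in> borel_measurable G" "w k \<in> borel_measurable G" by auto
qed

lemma half_iterate_measurable_from:
  assumes G: "space G = space M" "\<And>j. j < k \<Longrightarrow> gh j \<in> borel_measurable G" "\<And>j. j < k \<Longrightarrow> R j \<in> sets G"
    and [measurable]: "g k \<in> borel_measurable G"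
  shows "zh k \<in> borel_measurable G"
proof -
  have [measurable]: "z k \<in> borel_measurable G" "w k \<in> borel_measurable G"
    by (rule iterates_measurable_from[OF G], assumption+)+
  have "(\<lambda>\<omega>. prox \<gamma> h ((\<tau> *\<^sub>R z k \<omega> + (1 - \<tau>) *\<^sub>R w k \<omega>) - \<gamma> *\<^sub>R g k \<omega>)) \<in> borel_measurable G"
    by (rule measurable_compose[OF _ prox_borel_measurable[OF h gamma]]) measurable
  then show ?thesis
    by (subst measurable_cong[OF zh_eq]) (simp_all add: G(1))
qed

lemma iterates_measurable [measurable]:
  "z k \<in> borel_measurable M" "w k \<in> borel_measurable M" "zh k \<in> borel_measurable M"
  by (auto intro: iterates_measurable_from half_iterate_measurable_from)

abbreviation HH where "HH k \<equiv> history_half M g gh R k"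
abbreviation HF where "HF k \<equiv> history_full M g gh \<sigma> R k"

lemma history_half_generators:
  "(\<Union>j\<in>{..k}. preimages M (g j)) \<union> (\<Union>j\<in>{..<k}. preimages M (gh j)) \<union> R ` {..<k} \<subseteq> sets M"
  by (intro Un_least UN_least preimages_subset_sets image_subsetI) auto

lemma history_full_generators:
  "(\<Union>j\<in>{..k}. preimages M (g j) \<union> preimages M (gh j) \<union> preimages M (\<sigma> j)) \<union> R ` {..<k} \<subseteq> sets M"
  by (intro Un_least UN_least preimages_subset_sets image_subsetI) auto

lemma subalgebra_history_half: "subalgebra M (HH k)"
  unfolding history_half_def by (rule subalgebra_sigma[OF history_half_generators])

lemma subalgebra_history_full: "subalgebra M (HF k)"
  unfolding history_full_def by (rule subalgebra_sigma[OF history_full_generators])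

lemma history_space: "space (HH k) = space M" "space (HF k) = space M"
  using subalgebra_history_half subalgebra_history_full by (auto simp: subalgebra_def)

lemma history_half_measurable:
  "j \<le> k \<Longrightarrow> g j \<in> borel_measurable (HH k)"
  "j < k \<Longrightarrow> gh j \<in> borel_measurable (HH k)"
  "j < k \<Longrightarrow> R j \<in> sets (HH k)"
proof -
  note gen = order_trans[OF history_half_generators[of k] sets.space_closed]
  show "j \<le> k \<Longrightarrow> g j \<in> borel_measurable (HH k)" "j < k \<Longrightarrow> gh j \<in> borel_measurable (HH k)"
    unfolding history_half_def by (rule borel_measurable_sigma_preimages[OF gen]; blast)+
  show "j < k \<Longrightarrow> R j \<in> sets (HH k)"
    unfolding history_half_def sets_measure_of[OF gen] by (rule sigma_sets.Basic) blast
qed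

lemma history_full_measurable:
  "j \<le> k \<Longrightarrow> gh j \<in> borel_measurable (HF k)"
  "j < k \<Longrightarrow> R j \<in> sets (HF k)"
proof -
  note gen = order_trans[OF history_full_generators[of k] sets.space_closed]
  show "j \<le> k \<Longrightarrow> gh j \<in> borel_measurable (HF k)"
    unfolding history_full_def by (rule borel_measurable_sigma_preimages[OF gen]; blast)
  show "j < k \<Longrightarrow> R j \<in> sets (HF k)"
    unfolding history_full_def sets_measure_of[OF gen] by (rule sigma_sets.Basic) blast
qed

lemma history_half_mono:
  assumes "j \<le> k"
  shows "subalgebra (HH k) (HH j)"
proof -
  note gen = order_trans[OF history_half_generators sets.space_closed]
  show ?thesis
    unfolding subalgebra_def history_space
    unfolding history_half_def sets_measure_of[OF gen] using assms
    by (intro conjI refl sigma_sets_mono') force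
qed

lemma half_iterate_measurable_history: "zh k \<in> borel_measurable (HH k)"
  by (intro half_iterate_measurable_from history_half_measurable history_space) auto

text \<open>The indices differ on purpose: \<open>z (Suc k)\<close> depends on \<open>gh k\<close>
  but not on \<open>R k\<close>, so it is known before the refresh is decided, whereas
  \<open>w (Suc k)\<close> is not.\<close>

lemma iterates_measurable_history:
  "j \<le> Suc k \<Longrightarrow> z j \<in> borel_measurable (HF k)"
  "j \<le> k \<Longrightarrow> w j \<in> borel_measurable (HF k)"
proof -
  have *: "z j \<in> borel_measurable (HF k)" "w j \<in> borel_measurable (HF k)" if "j \<le> k" for j
    using that by (intro iterates_measurable_from history_full_measurable history_space; simp)+
  show "j \<le> k \<Longrightarrow> w j \<in> borel_measurable (HF k)" by (rule *(2))
  have "z (Suc k) \<in> borel_measurable (HF k)"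
  proof -
    have [measurable]: "z k \<in> borel_measurable (HF k)" "w k \<in> borel_measurable (HF k)" "gh k \<in> borel_measurable (HF k)"
      using * history_full_measurable by auto
    have "(\<lambda>\<omega>. prox \<gamma> h ((\<tau> *\<^sub>R z k \<omega> + (1 - \<tau>) *\<^sub>R w k \<omega>) - \<gamma> *\<^sub>R gh k \<omega>)) \<in> borel_measurable (HF k)"
      by (rule measurable_compose[OF _ prox_borel_measurable[OF h gamma]]) measurable
    then show ?thesis
      by (subst measurable_cong[OF z_Suc]) (simp_all add: history_space)
  qed
  then show "j \<le> Suc k \<Longrightarrow> z j \<in> borel_measurable (HF k)"
    using * le_Suc_eq by auto
qed

section \<open>Square integrability of the iterates\<close>

lemma square_integrable_gradient_change: "square_integrable M (\<lambda>\<omega>. gh k \<omega> - g k \<omega>)"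
  using diff_int by (simp add: square_integrable_def)

lemma square_integrable_half_step: "square_integrable M (\<lambda>\<omega>. zh k \<omega> - w k \<omega>)"
  using dist_int by (simp add: square_integrable_def)

text \<open>Both points are proximal points of arguments that differ only by
  \<open>\<gamma> (gh k - g k)\<close>.\<close>

lemma iterate_half_distance:
  assumes "\<omega> \<in> space M"
  shows "norm (z (Suc k) \<omega> - zh k \<omega>) \<le> \<gamma> * norm (gh k \<omega> - g k \<omega>)"
proof -
  have "norm (z (Suc k) \<omega> - zh k \<omega>) \<le> norm (- (\<gamma> *\<^sub>R (gh k \<omega> - g k \<omega>)))"
    unfolding z_Suc[OF assms] zh_eq[OF assms]
    by (rule order_trans[OF prox_nonexpansive[OF h gamma]]) (simp add: algebra_simps)
  then show ?thesis using gamma by simp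
qed

lemma square_integrable_correction: "square_integrable M (\<lambda>\<omega>. z (Suc k) \<omega> - zh k \<omega>)"
  by (rule square_integrable_bound[OF square_integrable_gradient_change _ iterate_half_distance]) measurable

text \<open>Induction from the deterministic start: \<open>z (Suc k)\<close> is the sum of the
  correction, the half step and \<open>w k\<close>, and \<open>w (Suc k)\<close> is pointwise one of
  \<open>z (Suc k)\<close> and \<open>w k\<close>, hence dominated by their squares
  together.\<close>

lemma square_integrable_iterates: "square_integrable M (z k)" "square_integrable M (w k)"
proof -
  have "square_integrable M (z k) \<and> square_integrable M (w k)"
  proof (induction k)
    case 0
    have "integrable M (\<lambda>\<omega>. (norm (z 0 \<omega>))\<^sup>2) \<longleftrightarrow> integrable M (\<lambda>\<omega>. (norm z0)\<^sup>2)"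
      "integrable M (\<lambda>\<omega>. (norm (w 0 \<omega>))\<^sup>2) \<longleftrightarrow> integrable M (\<lambda>\<omega>. (norm z0)\<^sup>2)"
      by (rule Bochner_Integration.integrable_cong; simp add: z_0 w_0)+
    then show ?case by (simp add: square_integrable_def)
  next
    case (Suc k)
    have "square_integrable M (\<lambda>\<omega>. (z (Suc k) \<omega> - zh k \<omega>) + ((zh k \<omega> - w k \<omega>) + w k \<omega>))"
      using Suc square_integrable_correction square_integrable_half_step
      by (intro square_integrable_add) auto
    then have z: "square_integrable M (z (Suc k))" by simp
    have "integrable M (\<lambda>\<omega>. (norm (z (Suc k) \<omega>))\<^sup>2 + (norm (w k \<omega>))\<^sup>2)"
      using z Suc by (simp add: square_integrable_def)
    then have "integrable M (\<lambda>\<omega>. (norm (w (Suc k) \<omega>))\<^sup>2)"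
      by (rule Bochner_Integration.integrable_bound) (auto simp: w_Suc intro!: AE_I2)
    with z show ?case by (simp add: square_integrable_def)
  qed
  then show "square_integrable M (z k)" "square_integrable M (w k)" by auto
qed

lemma square_integrable_half_iterate: "square_integrable M (zh k)"
  using square_integrable_add[OF square_integrable_half_step square_integrable_iterates(2), of k k] by simp

text \<open>The new value is \<open>\<phi> (w k)\<close> plus \<open>indicator (R k)\<close> times a
  difference that is measurable before the refresh, so the indicator may be replaced by its
  probability.\<close>

lemma refresh_expectation:
  fixes \<phi> :: "'n \<Rightarrow> real"
  assumes [measurable]: "\<phi> \<in> borel_measurable borel"
    and int: "integrable M (\<lambda>\<omega>. \<phi> (z (Suc k) \<omega>))" "integrable M (\<lambda>\<omega>. \<phi> (w k \<omega>))"
  shows "(\<integral>\<omega>. \<phi> (w (Suc k) \<omega>) \<partial>M) = (1 - \<tau>) * (\<integral>\<omega>. \<phi> (z (Suc k) \<omega>) \<partial>M) + \<tau> * (\<integral>\<omega>. \<phi> (w k \<omega>) \<partial>M)"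
proof -
  have [measurable]: "z (Suc k) \<in> borel_measurable (HF k)" "w k \<in> borel_measurable (HF k)"
    by (simp_all add: iterates_measurable_history)
  let ?X = "\<lambda>\<omega>. \<phi> (z (Suc k) \<omega>) - \<phi> (w k \<omega>)"
  have iX: "integrable M ?X" using int by simp
  have "(\<integral>\<omega>. indicator (R k) \<omega> * ?X \<omega> \<partial>M) = prob (R k) * (\<integral>\<omega>. ?X \<omega> \<partial>M)"
    by (rule integral_indicator_mult_indep[OF subalgebra_history_full indep_R R_meas _ iX]) measurable
  moreover have "(\<integral>\<omega>. \<phi> (w (Suc k) \<omega>) \<partial>M) = (\<integral>\<omega>. \<phi> (w k \<omega>) + indicator (R k) \<omega> * ?X \<omega> \<partial>M)"
    by (rule Bochner_Integration.integral_cong) (auto simp: w_Suc)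
  moreover have "integrable M (\<lambda>\<omega>. indicator (R k) \<omega> * ?X \<omega>)"
    using integrable_mult_indicator[OF R_meas iX] by simp
  then have "(\<integral>\<omega>. \<phi> (w k \<omega>) + indicator (R k) \<omega> * ?X \<omega> \<partial>M)
      = (\<integral>\<omega>. \<phi> (w k \<omega>) \<partial>M) + (\<integral>\<omega>. indicator (R k) \<omega> * ?X \<omega> \<partial>M)"
    by (rule Bochner_Integration.integral_add[OF int(2)])
  moreover have "(\<integral>\<omega>. ?X \<omega> \<partial>M) = (\<integral>\<omega>. \<phi> (z (Suc k) \<omega>) \<partial>M) - (\<integral>\<omega>. \<phi> (w k \<omega>) \<partial>M)"
    by (rule Bochner_Integration.integral_diff[OF int])
  ultimately show ?thesis
    unfolding prob_R by algebra
qed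

section \<open>The solution of the variational inequality\<close>

lemma half_iterate_in_domain: "\<omega> \<in> space M \<Longrightarrow> zh k \<omega> \<in> domain_of h"
  by (simp add: zh_eq prox_in_domain[OF h gamma])

text \<open>If \<open>h zs\<close> were infinite, the variational inequality tested at a point with
  finite \<open>h\<close> would read \<open>-\<infinity> \<ge> 0\<close>.\<close>

lemma solution_in_domain: "zs \<in> domain_of h"
proof -
  obtain x where x: "h x < \<infinity>" "h x \<noteq> -\<infinity>" using h(1) by (auto simp: proper_fun_def)
  then have "x \<in> Z" using domZ by (auto simp: domain_of_def)
  then have "0 \<le> ereal (F zs \<bullet> (x - zs)) + h x - h zs"
    using zs by (simp add: vi_solution_def)
  then show ?thesis
    using x by (cases "h x"; cases "h zs") (auto simp: domain_of_def)
qed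

lemma domain_finite: "x \<in> domain_of h \<Longrightarrow> h x = ereal (real_of_ereal (h x))"
  using h(1) by (cases "h x") (auto simp: domain_of_def proper_fun_def)

text \<open>The variational inequality as an inclusion. It is given only on \<open>Z\<close>, but
  extends to all points because \<open>h\<close> is infinite outside \<open>Z\<close>.\<close>

lemma solution_subgradient: "- F zs \<in> subdifferential h zs"
proof -
  obtain a where a: "h zs = ereal a" using domain_finite[OF solution_in_domain] by metis
  have "h zs + ereal (- F zs \<bullet> (y - zs)) \<le> h y" for y
  proof (cases "y \<in> domain_of h")
    case True
    then obtain b where b: "h y = ereal b" using domain_finite by metis
    have "0 \<le> ereal (F zs \<bullet> (y - zs)) + h y - h zs"
      using zs True domZ by (auto simp: vi_solution_def)
    then show ?thesis by (simp add: a b)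
  next
    case False
    then show ?thesis by (simp add: domain_of_def)
  qed
  then show ?thesis by (simp add: subdifferential_def a)
qed

text \<open>Strong convexity is used at \<open>zs\<close> with the subgradient
  \<open>- F zs\<close>, whose linear term cancels the one that strong monotonicity leaves
  behind.\<close>

lemma solution_growth:
  assumes "strongly_monotone_on Z F \<mu>F" "strongly_convex_on Z h \<mu>h" "x \<in> domain_of h"
  shows "(\<mu>F + \<mu>h / 2) * (norm (x - zs))\<^sup>2
    \<le> F x \<bullet> (x - zs) + real_of_ereal (h x) - real_of_ereal (h zs)"
proof -
  obtain a where a: "h zs = ereal a" using domain_finite[OF solution_in_domain] by metis
  obtain b where b: "h x = ereal b" using domain_finite[OF assms(3)] by metis
  have Z: "x \<in> Z" "zs \<in> Z" using assms(3) domZ zs by (auto simp: vi_solution_def)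
  have "\<mu>F * (norm (x - zs))\<^sup>2 \<le> (F x - F zs) \<bullet> (x - zs)"
    using assms(1) Z by (simp add: strongly_monotone_on_def)
  moreover have "ereal (\<mu>h / 2 * (norm (x - zs))\<^sup>2) \<le> h x - h zs - ereal (- F zs \<bullet> (x - zs))"
    using assms(2) Z solution_subgradient unfolding strongly_convex_on_def by blast
  ultimately show ?thesis by (simp add: a b inner_diff_left algebra_simps)
qed

text \<open>
  \<open>F\<close> need not be measurable, so the noise is written with the conditional expectation, which agrees
  with \<open>F\<close> at the half iterate almost everywhere.
\<close>

lemma residual_square_integrable:
  assumes sub: "subalgebra M G" and ae: "AE \<omega> in M. vec_cond_exp M G (gh k) \<omega> = F (zh k \<omega>)"
  shows "square_integrable M (\<lambda>\<omega>. gh k \<omega> - vec_cond_exp M G (gh k) \<omega>)"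
    and "(\<integral>\<omega>. (norm (gh k \<omega> - vec_cond_exp M G (gh k) \<omega>))\<^sup>2 \<partial>M) = (\<integral>\<omega>. (norm (gh k \<omega> - F (zh k \<omega>)))\<^sup>2 \<partial>M)"
proof -
  have [measurable]: "vec_cond_exp M G (gh k) \<in> borel_measurable M"
    by (rule measurable_from_subalg[OF sub vec_cond_exp_borel_measurable])
  have meas: "(\<lambda>\<omega>. (norm (gh k \<omega> - F (zh k \<omega>)))\<^sup>2) \<in> borel_measurable M"
    using noise_int[of k] by (rule borel_measurable_integrable)
  have eq: "AE \<omega> in M. (norm (gh k \<omega> - F (zh k \<omega>)))\<^sup>2 = (norm (gh k \<omega> - vec_cond_exp M G (gh k) \<omega>))\<^sup>2"
    using ae by eventually_elim simp
  have "integrable M (\<lambda>\<omega>. (norm (gh k \<omega> - vec_cond_exp M G (gh k) \<omega>))\<^sup>2)"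
    by (rule integrable_cong_AE_imp[OF noise_int[of k] _ eq]) measurable
  then show "square_integrable M (\<lambda>\<omega>. gh k \<omega> - vec_cond_exp M G (gh k) \<omega>)"
    by (simp add: square_integrable_def)
  show "(\<integral>\<omega>. (norm (gh k \<omega> - vec_cond_exp M G (gh k) \<omega>))\<^sup>2 \<partial>M) = (\<integral>\<omega>. (norm (gh k \<omega> - F (zh k \<omega>)))\<^sup>2 \<partial>M)"
    by (rule integral_cong_AE[OF _ meas]) (use eq in \<open>auto elim: eventually_mono\<close>)
qed

lemma subalgebra_vimage_half_iterate: "subalgebra M (vimage_algebra (space M) (zh k) borel)"
  using iterates_measurable(3)[of k] by (auto simp: subalgebra_def sets_vimage_algebra2 measurable_sets)

lemma shifted_square_integrable:
  "square_integrable M (\<lambda>\<omega>. z k \<omega> - u)" "square_integrable M (\<lambda>\<omega>. w k \<omega> - u)"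
  "square_integrable M (\<lambda>\<omega>. zh k \<omega> - u)" "square_integrable M (\<lambda>\<omega>. z k \<omega> - zh k \<omega>)"
  using square_integrable_iterates square_integrable_half_iterate by (auto simp del: square_integrable_def)

text \<open>As \<open>zs\<close> is deterministic, \<open>zh k - zs\<close> is measurable with
  respect to \<open>zh k\<close>; conditioning on the half iterate alone therefore makes the pairing
  with the noise integrate to zero.\<close>

lemma expected_descent:
  assumes mono: "strongly_monotone_on Z F \<mu>F" "strongly_convex_on Z h \<mu>h"
    and ae: "AE \<omega> in M. vec_cond_exp M (vimage_algebra (space M) (zh k) borel) (gh k) \<omega> = F (zh k \<omega>)"
  shows "(\<integral>\<omega>. (norm (z (Suc k) \<omega> - zs))\<^sup>2 \<partial>M)
    \<le> \<tau> * (\<integral>\<omega>. (norm (z k \<omega> - zs))\<^sup>2 \<partial>M) + (1 - \<tau>) * (\<integral>\<omega>. (norm (w k \<omega> - zs))\<^sup>2 \<partial>M)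
      - \<tau> * (\<integral>\<omega>. (norm (z k \<omega> - zh k \<omega>))\<^sup>2 \<partial>M) - (1 - \<tau>) * (\<integral>\<omega>. (norm (zh k \<omega> - w k \<omega>))\<^sup>2 \<partial>M)
      + 2 * \<gamma>\<^sup>2 * (\<integral>\<omega>. (norm (gh k \<omega> - g k \<omega>))\<^sup>2 \<partial>M)
      - 2 * \<gamma> * (\<mu>F + \<mu>h / 2) * (\<integral>\<omega>. (norm (zh k \<omega> - zs))\<^sup>2 \<partial>M)"
proof -
  let ?G = "vimage_algebra (space M) (zh k) borel"
  define N where "N = (\<lambda>\<omega>. gh k \<omega> - vec_cond_exp M ?G (gh k) \<omega>)"
  note N = residual_square_integrable(1)[OF subalgebra_vimage_half_iterate ae, folded N_def]
  have "zh k \<in> borel_measurable ?G"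
    by (rule measurable_vimage_algebra1) simp
  then have "(\<lambda>\<omega>. zh k \<omega> - zs) \<in> borel_measurable ?G" by measurable
  then have N0: "(\<integral>\<omega>. N \<omega> \<bullet> (zh k \<omega> - zs) \<partial>M) = 0"
    unfolding N_def
    by (rule cond_exp_residual_orthogonal[OF subalgebra_vimage_half_iterate gh_int _ shifted_square_integrable(3) N[unfolded N_def]])
  note ints = shifted_square_integrable[THEN square_integrable_norm] diff_int dist_int
    square_integrable_inner[OF N shifted_square_integrable(3)]
  let ?rhs = "\<lambda>\<omega>. \<tau> * (norm (z k \<omega> - zs))\<^sup>2 + (1 - \<tau>) * (norm (w k \<omega> - zs))\<^sup>2
      - \<tau> * (norm (z k \<omega> - zh k \<omega>))\<^sup>2 - (1 - \<tau>) * (norm (zh k \<omega> - w k \<omega>))\<^sup>2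
      + 2 * \<gamma>\<^sup>2 * (norm (gh k \<omega> - g k \<omega>))\<^sup>2
      - 2 * \<gamma> * (\<mu>F + \<mu>h / 2) * (norm (zh k \<omega> - zs))\<^sup>2 - 2 * \<gamma> * (N \<omega> \<bullet> (zh k \<omega> - zs))"
  have "(\<integral>\<omega>. (norm (z (Suc k) \<omega> - zs))\<^sup>2 \<partial>M) \<le> (\<integral>\<omega>. ?rhs \<omega> \<partial>M)"
  proof (rule integral_mono_AE)
    show "AE \<omega> in M. (norm (z (Suc k) \<omega> - zs))\<^sup>2 \<le> ?rhs \<omega>"
      using ae AE_space
    proof eventually_elim
      case (elim \<omega>)
      have "gh k \<omega> = N \<omega> + F (zh k \<omega>)" using elim by (simp add: N_def)
      then have "2 * \<gamma> * (gh k \<omega> \<bullet> (zh k \<omega> - zs) + real_of_ereal (h (zh k \<omega>)) - real_of_ereal (h zs))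
          = 2 * \<gamma> * (N \<omega> \<bullet> (zh k \<omega> - zs))
            + 2 * \<gamma> * (F (zh k \<omega>) \<bullet> (zh k \<omega> - zs) + real_of_ereal (h (zh k \<omega>)) - real_of_ereal (h zs))"
        by (simp add: inner_add_left algebra_simps)
      moreover have "2 * \<gamma> * ((\<mu>F + \<mu>h / 2) * (norm (zh k \<omega> - zs))\<^sup>2)
          \<le> 2 * \<gamma> * (F (zh k \<omega>) \<bullet> (zh k \<omega> - zs) + real_of_ereal (h (zh k \<omega>)) - real_of_ereal (h zs))"
        using gamma solution_growth[OF mono half_iterate_in_domain[OF elim(2)]] by (intro mult_left_mono) auto
      moreover have "0 \<le> (norm (z (Suc k) \<omega> - zh k \<omega>))\<^sup>2" by simp
      ultimately show ?case
        using extragradient_step[OF h gamma solution_in_domain zh_eq[OF elim(2)] z_Suc[OF elim(2)], of k]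
        unfolding mult.assoc[of _ "\<mu>F + \<mu>h / 2"] by linarith
    qed
    show "integrable M ?rhs"
      by (intro Bochner_Integration.integrable_add Bochner_Integration.integrable_diff integrable_mult_right ints)
  qed (rule ints)
  also have "(\<integral>\<omega>. ?rhs \<omega> \<partial>M) = \<tau> * (\<integral>\<omega>. (norm (z k \<omega> - zs))\<^sup>2 \<partial>M) + (1 - \<tau>) * (\<integral>\<omega>. (norm (w k \<omega> - zs))\<^sup>2 \<partial>M)
      - \<tau> * (\<integral>\<omega>. (norm (z k \<omega> - zh k \<omega>))\<^sup>2 \<partial>M) - (1 - \<tau>) * (\<integral>\<omega>. (norm (zh k \<omega> - w k \<omega>))\<^sup>2 \<partial>M)
      + 2 * \<gamma>\<^sup>2 * (\<integral>\<omega>. (norm (gh k \<omega> - g k \<omega>))\<^sup>2 \<partial>M)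
      - 2 * \<gamma> * (\<mu>F + \<mu>h / 2) * (\<integral>\<omega>. (norm (zh k \<omega> - zs))\<^sup>2 \<partial>M)"
    using N0 by (simp add: ints)
  finally show ?thesis .
qed

end

section \<open>Linear convergence in the strongly monotone case\<close>

text \<open>One step of the recursion in terms of expected squares: \<open>a\<close>,
  \<open>b\<close>, \<open>c\<close> are those of the distances of \<open>z\<close>,
  \<open>w\<close> and the half iterate to the solution; \<open>p\<close> and \<open>d\<close> those
  of the distances of the half iterate to \<open>z\<close> and \<open>w\<close>; \<open>e\<close>
  belongs to the change of estimator and \<open>s\<close> to \<sigma>. Primes mark the next
  step.\<close>

lemma lyapunov_arithmetic:
  fixes \<tau> \<gamma> \<mu> \<rho> A B C D1 D2 T a a' b b' c d e p s s' :: real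
  assumes a': "a' \<le> \<tau> * a + (1 - \<tau>) * b - \<tau> * p - (1 - \<tau>) * d + 2 * \<gamma>\<^sup>2 * e - \<gamma> * \<mu> * c"
    and b': "b' = (1 - \<tau>) * a' + \<tau> * b"
    and e: "e \<le> A * d + B * s + D1" and s': "s' \<le> (1 - \<rho>) * s + C * d + D2"
    and a: "a \<le> 2 * p + 2 * c" and b: "b \<le> 2 * d + 2 * c"
    and step: "4 * \<gamma>\<^sup>2 * (2 * A + T * C) \<le> 1 - \<tau>" "4 * (\<gamma> * \<mu>) \<le> 1 - \<tau>" "4 * B \<le> T * \<rho>"
    and nn: "0 \<le> \<tau>" "\<tau> \<le> 1" "0 \<le> T" "0 \<le> \<gamma> * \<mu>" "0 \<le> a" "0 \<le> b" "0 \<le> c" "0 \<le> d" "0 \<le> p" "0 \<le> s"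
  shows "\<tau> * a' + b' + T * \<gamma>\<^sup>2 * s'
    \<le> max (1 - \<gamma> * \<mu> / 16) (1 - \<rho> / 2) * (\<tau> * a + b + T * \<gamma>\<^sup>2 * s) + \<gamma>\<^sup>2 * (2 * D1 + T * D2)"
proof -
  define m where "m = \<gamma> * \<mu>"
  have m: "0 \<le> m" "4 * m \<le> 1 - \<tau>" "m \<le> 1"
    using nn step by (auto simp: m_def)
  define G where "G = \<gamma>\<^sup>2"
  have G: "0 \<le> G" by (simp add: G_def)
  have "G * e \<le> G * (A * d + B * s + D1)"
    using e G by (intro mult_left_mono) auto
  then have 1: "G * e \<le> G * A * d + G * B * s + G * D1"
    by (simp add: algebra_simps)
  have "T * G * s' \<le> T * G * ((1 - \<rho>) * s + C * d + D2)"
    using s' nn G by (intro mult_left_mono) auto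
  then have 2: "T * G * s' \<le> T * G * s - T * G * s * \<rho> + T * G * C * d + T * G * D2"
    by (simp add: algebra_simps)
  \<comment> \<open>The step size makes the two costs proportional to \<open>d\<close>, namely
    \<open>2 G A d\<close> and \<open>T G C d\<close>, together at most a quarter of the available
    \<open>(1 - \<tau>) d\<close>.\<close>
  have "4 * G * (2 * A + T * C) * d \<le> (1 - \<tau>) * d"
    using step nn by (intro mult_right_mono) (auto simp: G_def)
  moreover have "4 * G * (2 * A + T * C) * d = 8 * (G * A * d) + 4 * (T * G * C * d)"
    by (simp add: algebra_simps)
  ultimately have 3: "8 * (G * A * d) + 4 * (T * G * C * d) \<le> (1 - \<tau>) * d" by simp
  \<comment> \<open>The lower bound on \<open>T\<close> lets \<open>2 G B s\<close> use at most half
    of the decrease \<open>T G s \<rho>\<close>; hence the rate \<open>\<rho> / 2\<close>.\<close>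
  have "G * s * (4 * B) \<le> G * s * (T * \<rho>)"
    using step nn G by (intro mult_left_mono) auto
  then have 4: "4 * (G * B * s) \<le> T * G * s * \<rho>" by (simp add: mult_ac)
  \<comment> \<open>For a contraction by \<open>m / 16\<close> these bounds cost at most
    \<open>m c / 4\<close>, \<open>\<tau> p / 8\<close> and \<open>(1 - \<tau>) d / 32\<close>,
    which fit into what remains of the negative terms.\<close>
  have "\<tau> * m * a \<le> \<tau> * m * (2 * p + 2 * c)" "m * b \<le> m * (2 * d + 2 * c)"
    using a b m nn by (auto intro!: mult_left_mono)
  then have 5: "m * (\<tau> * a) \<le> 2 * (m * (\<tau> * p)) + 2 * (\<tau> * (m * c))" "m * b \<le> 2 * (m * d) + 2 * (m * c)"
    by (simp_all add: algebra_simps)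
  have "4 * m * d \<le> (1 - \<tau>) * d"
    using m nn by (intro mult_right_mono; simp)
  then have 6: "4 * (m * d) \<le> (1 - \<tau>) * d" by simp
  have 7: "m * (\<tau> * p) \<le> \<tau> * p" "\<tau> * (m * c) \<le> m * c"
    using m nn by (auto intro!: mult_left_le_one_le)
  have 8: "0 \<le> m * c" "0 \<le> \<tau> * p" "0 \<le> (1 - \<tau>) * d" using m nn by auto
  have 9: "a' \<le> \<tau> * a + (1 - \<tau>) * b - \<tau> * p - (1 - \<tau>) * d + 2 * (G * e) - m * c"
    using a' by (simp add: m_def G_def)
  have "\<tau> * a' + b' + T * G * s' = a' + \<tau> * b + T * G * s'"
    unfolding b' by (simp add: algebra_simps)
  also have "\<dots> \<le> \<tau> * a + b - m * (\<tau> * a) / 16 - m * b / 16 + T * G * s - T * G * s * \<rho> / 2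
      + 2 * (G * D1) + T * G * D2"
    using 1 2 3 4 5 6 7 8 9 left_diff_distrib[of 1 \<tau> b] by linarith
  also have "\<dots> = (1 - m / 16) * (\<tau> * a + b) + (1 - \<rho> / 2) * (T * G * s) + G * (2 * D1 + T * D2)"
    by (simp add: algebra_simps)
  finally have "\<tau> * a' + b' + T * \<gamma>\<^sup>2 * s'
    \<le> (1 - m / 16) * (\<tau> * a + b) + (1 - \<rho> / 2) * (T * \<gamma>\<^sup>2 * s) + \<gamma>\<^sup>2 * (2 * D1 + T * D2)"
    by (simp only: G_def)
  also have "\<dots> \<le> max (1 - m / 16) (1 - \<rho> / 2) * (\<tau> * a + b) + max (1 - m / 16) (1 - \<rho> / 2) * (T * \<gamma>\<^sup>2 * s)
      + \<gamma>\<^sup>2 * (2 * D1 + T * D2)"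
    using nn by (intro add_right_mono add_mono mult_right_mono) auto
  finally show ?thesis by (simp add: m_def algebra_simps)
qed

section \<open>From one step to the linear rate\<close>

text \<open>\<open>c / (1 - q)\<close> is the fixed point of \<open>x = q x + c\<close>, so the
  induction step reproduces it exactly.\<close>

lemma affine_recursion_bound:
  fixes v :: "nat \<Rightarrow> real"
  assumes "\<And>k. v (Suc k) \<le> q * v k + c" "0 \<le> q" "q < 1" "0 \<le> c"
  shows "v k \<le> q ^ k * v 0 + c / (1 - q)"
proof (induction k)
  case (Suc k)
  have "v (Suc k) \<le> q * (q ^ k * v 0 + c / (1 - q)) + c"
    using assms(1)[of k] mult_left_mono[OF Suc assms(2)] by linarith
  also have "\<dots> = q ^ Suc k * v 0 + c / (1 - q)"
    using assms(3) by (simp add: field_simps)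
  finally show ?case .
qed (use assms in auto)

text \<open>The quotient is extended-valued so that a zero denominator imposes no restriction when
  \<open>0 < t\<close>; for \<open>x = 0\<close> the conclusion is just
  \<open>0 \<le> t\<close>.\<close>

lemma ereal_stepsize_bound:
  assumes "ereal \<gamma> \<le> ereal (sqrt t) / ereal (2 * sqrt x)" "0 < \<gamma>" "0 \<le> x" "0 \<le> t"
  shows "4 * \<gamma>\<^sup>2 * x \<le> t"
proof (cases "x = 0")
  case False
  then have "\<gamma> * (2 * sqrt x) \<le> sqrt t"
    using assms by (simp add: field_simps)
  then have "(\<gamma> * (2 * sqrt x))\<^sup>2 \<le> (sqrt t)\<^sup>2"
    using assms by (intro power_mono) auto
  then show ?thesis using assms by (simp add: power_mult_distrib mult_ac)
qed (use assms in simp)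

lemma (in stochastic_extragradient) lyapunov_linear_convergence:
  assumes sig: "\<And>k. integrable M (\<lambda>\<omega>. (\<sigma> k \<omega>)\<^sup>2)" and sig0: "\<And>\<omega>. \<omega> \<in> space M \<Longrightarrow> \<sigma> 0 \<omega> = \<sigma>0"
    and ae: "\<And>k. AE \<omega> in M. vec_cond_exp M (vimage_algebra (space M) (zh k) borel) (gh k) \<omega> = F (zh k \<omega>)"
    and nonneg: "0 \<le> D1" "0 \<le> D2" "0 < \<rho>" "\<rho> \<le> 1" "0 < T"
    and e: "\<And>k. (\<integral>\<omega>. (norm (gh k \<omega> - g k \<omega>))\<^sup>2 \<partial>M)
           \<le> A * (\<integral>\<omega>. (norm (zh k \<omega> - w k \<omega>))\<^sup>2 \<partial>M) + B * (\<integral>\<omega>. (\<sigma> k \<omega>)\<^sup>2 \<partial>M) + D1"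
    and s: "\<And>k. (\<integral>\<omega>. (\<sigma> (Suc k) \<omega>)\<^sup>2 \<partial>M)
           \<le> (1 - \<rho>) * (\<integral>\<omega>. (\<sigma> k \<omega>)\<^sup>2 \<partial>M) + C * (\<integral>\<omega>. (norm (zh k \<omega> - w k \<omega>))\<^sup>2 \<partial>M) + D2"
    and mu: "0 \<le> \<mu>F" "0 \<le> \<mu>h" "0 < \<mu>F + \<mu>h"
    and mono: "strongly_monotone_on Z F \<mu>F" "strongly_convex_on Z h \<mu>h"
    and step: "4 * \<gamma>\<^sup>2 * (2 * A + T * C) \<le> 1 - \<tau>" "4 * (\<gamma> * (\<mu>F + \<mu>h)) \<le> 1 - \<tau>" "4 * B \<le> T * \<rho>"
  shows "(\<integral>\<^sup>+\<omega>. ennreal (lyapunov \<tau> T \<gamma> zs (z K \<omega>) (w K \<omega>) (\<sigma> K \<omega>)) \<partial>M)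
        \<le> ennreal
            (max ((1 - \<gamma> * ((\<mu>F + \<mu>h) / 16)) ^ (K - 1)) ((1 - \<rho> / 2) ^ (K - 1))
               * lyapunov \<tau> T \<gamma> zs z0 z0 \<sigma>0
             + \<gamma>\<^sup>2 * (2 * D1 + T * D2) / min (\<gamma> * ((\<mu>F + \<mu>h) / 16)) (\<rho> / 2))"
proof -
  define \<mu> where "\<mu> = \<mu>F + \<mu>h"
  define x where "x = 1 - \<gamma> * (\<mu> / 16)"
  define y where "y = 1 - \<rho> / 2"
  define q where "q = max x y"
  define L where "L = (\<lambda>k \<omega>. lyapunov \<tau> T \<gamma> zs (z k \<omega>) (w k \<omega>) (\<sigma> k \<omega>))"
  define v where "v = (\<lambda>k. \<integral>\<omega>. L k \<omega> \<partial>M)"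
  note ints = shifted_square_integrable[THEN square_integrable_norm] dist_int sig
  have \<mu>: "0 < \<gamma> * \<mu>" "4 * (\<gamma> * \<mu>) \<le> 1 - \<tau>" using gamma mu step by (auto simp: \<mu>_def)
  have xy: "0 \<le> x" "x < 1" "0 \<le> y" "y < 1"
    using \<mu> nonneg tau by (auto simp: x_def y_def)
  then have q: "0 \<le> q" "q < 1" by (auto simp: q_def)
  have L: "integrable M (L k)" for k
    unfolding L_def lyapunov_def
    by (intro Bochner_Integration.integrable_add integrable_mult_right ints)
  have v: "v k = \<tau> * (\<integral>\<omega>. (norm (z k \<omega> - zs))\<^sup>2 \<partial>M) + (\<integral>\<omega>. (norm (w k \<omega> - zs))\<^sup>2 \<partial>M)
      + T * \<gamma>\<^sup>2 * (\<integral>\<omega>. (\<sigma> k \<omega>)\<^sup>2 \<partial>M)" for k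
    unfolding v_def L_def lyapunov_def by (simp add: ints)
  have "v (Suc k) \<le> q * v k + \<gamma>\<^sup>2 * (2 * D1 + T * D2)" for k
  proof -
    let ?c = "\<integral>\<omega>. (norm (zh k \<omega> - zs))\<^sup>2 \<partial>M" and ?d = "\<integral>\<omega>. (norm (zh k \<omega> - w k \<omega>))\<^sup>2 \<partial>M"
      and ?p = "\<integral>\<omega>. (norm (z k \<omega> - zh k \<omega>))\<^sup>2 \<partial>M"
    have a: "(\<integral>\<omega>. (norm (z k \<omega> - zs))\<^sup>2 \<partial>M) \<le> 2 * ?p + 2 * ?c"
    proof -
      have "(\<integral>\<omega>. (norm (z k \<omega> - zs))\<^sup>2 \<partial>M)
          \<le> (\<integral>\<omega>. 2 * (norm (z k \<omega> - zh k \<omega>))\<^sup>2 + 2 * (norm (zh k \<omega> - zs))\<^sup>2 \<partial>M)"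
        by (intro integral_mono Bochner_Integration.integrable_add integrable_mult_right ints norm_diff_power2_le)
      then show ?thesis by (simp add: ints)
    qed
    have w_dist: "(norm (w k \<omega> - zs))\<^sup>2 \<le> 2 * (norm (zh k \<omega> - w k \<omega>))\<^sup>2 + 2 * (norm (zh k \<omega> - zs))\<^sup>2" for \<omega>
      using norm_diff_power2_le[of "w k \<omega>" zs "zh k \<omega>"] by (simp only: norm_minus_commute[of "w k \<omega>" "zh k \<omega>"])
    have b: "(\<integral>\<omega>. (norm (w k \<omega> - zs))\<^sup>2 \<partial>M) \<le> 2 * ?d + 2 * ?c"
    proof -
      have "(\<integral>\<omega>. (norm (w k \<omega> - zs))\<^sup>2 \<partial>M)
          \<le> (\<integral>\<omega>. 2 * (norm (zh k \<omega> - w k \<omega>))\<^sup>2 + 2 * (norm (zh k \<omega> - zs))\<^sup>2 \<partial>M)"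
        by (intro integral_mono Bochner_Integration.integrable_add integrable_mult_right ints w_dist)
      then show ?thesis by (simp add: ints)
    qed
    \<comment> \<open>The coefficient on the right is
      \<open>2 \<gamma> \<mu>F + \<gamma> \<mu>h\<close>.\<close>
    have "\<gamma> * \<mu> \<le> 2 * \<gamma> * (\<mu>F + \<mu>h / 2)"
      using gamma mu by (simp add: \<mu>_def algebra_simps)
    then have "\<gamma> * \<mu> * ?c \<le> 2 * \<gamma> * (\<mu>F + \<mu>h / 2) * ?c"
      by (rule mult_right_mono) simp
    with expected_descent[OF mono ae, of k] have a': "(\<integral>\<omega>. (norm (z (Suc k) \<omega> - zs))\<^sup>2 \<partial>M)
      \<le> \<tau> * (\<integral>\<omega>. (norm (z k \<omega> - zs))\<^sup>2 \<partial>M) + (1 - \<tau>) * (\<integral>\<omega>. (norm (w k \<omega> - zs))\<^sup>2 \<partial>M)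
        - \<tau> * ?p - (1 - \<tau>) * ?d + 2 * \<gamma>\<^sup>2 * (\<integral>\<omega>. (norm (gh k \<omega> - g k \<omega>))\<^sup>2 \<partial>M) - \<gamma> * \<mu> * ?c"
      by linarith
    have b': "(\<integral>\<omega>. (norm (w (Suc k) \<omega> - zs))\<^sup>2 \<partial>M)
      = (1 - \<tau>) * (\<integral>\<omega>. (norm (z (Suc k) \<omega> - zs))\<^sup>2 \<partial>M) + \<tau> * (\<integral>\<omega>. (norm (w k \<omega> - zs))\<^sup>2 \<partial>M)"
      by (rule refresh_expectation) (simp_all add: ints)
    show ?thesis
      using lyapunov_arithmetic[OF a' b' e s a b step(1) \<mu>(2) step(3)] tau nonneg \<mu>
      by (simp add: v q_def x_def y_def)
  qed
  then have "v K \<le> q ^ K * v 0 + \<gamma>\<^sup>2 * (2 * D1 + T * D2) / (1 - q)"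
    using q nonneg by (intro affine_recursion_bound) auto
  also have "v 0 = lyapunov \<tau> T \<gamma> zs z0 z0 \<sigma>0"
  proof -
    have "v 0 = (\<integral>\<omega>. lyapunov \<tau> T \<gamma> zs z0 z0 \<sigma>0 \<partial>M)"
      unfolding v_def L_def by (rule Bochner_Integration.integral_cong) (simp_all add: z_0 w_0 sig0)
    then show ?thesis by (simp add: prob_space)
  qed
  \<comment> \<open>The recursion yields exponent \<open>K\<close>; it is relaxed to
    \<open>K - 1\<close>, using \<open>0 \<le> q \<le> 1\<close> and the nonnegative initial
    value.\<close>
  also have "q ^ K * lyapunov \<tau> T \<gamma> zs z0 z0 \<sigma>0 \<le> q ^ (K - 1) * lyapunov \<tau> T \<gamma> zs z0 z0 \<sigma>0"
    using q tau nonneg by (intro mult_right_mono power_decreasing) (auto simp: lyapunov_def)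
  also have "q ^ (K - 1) = max (x ^ (K - 1)) (y ^ (K - 1))"
    using xy by (auto simp: q_def max_def intro!: antisym power_mono)
  also have "1 - q = min (\<gamma> * (\<mu> / 16)) (\<rho> / 2)"
    by (auto simp: q_def x_def y_def)
  finally have final: "v K \<le> max (x ^ (K - 1)) (y ^ (K - 1)) * lyapunov \<tau> T \<gamma> zs z0 z0 \<sigma>0
      + \<gamma>\<^sup>2 * (2 * D1 + T * D2) / min (\<gamma> * (\<mu> / 16)) (\<rho> / 2)"
    by simp
  have "(\<integral>\<^sup>+\<omega>. ennreal (L K \<omega>) \<partial>M) = ennreal (v K)"
    unfolding v_def
    by (rule nn_integral_eq_integral[OF L]) (use tau nonneg in \<open>auto simp: L_def lyapunov_def\<close>)
  also have "\<dots> \<le> ennreal (max (x ^ (K - 1)) (y ^ (K - 1)) * lyapunov \<tau> T \<gamma> zs z0 z0 \<sigma>0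
      + \<gamma>\<^sup>2 * (2 * D1 + T * D2) / min (\<gamma> * (\<mu> / 16)) (\<rho> / 2))"
    by (rule ennreal_leI[OF final])
  finally show ?thesis by (simp only: L_def x_def y_def \<mu>_def)
qed

section \<open>Ergodic convergence in the monotone case\<close>

context stochastic_extragradient
begin

text \<open>Centered with respect to the whole history rather than the half iterate, which makes it
  orthogonal to the noise of earlier steps.\<close>

definition noise :: "nat \<Rightarrow> 'w \<Rightarrow> 'n" where
  "noise k \<omega> = gh k \<omega> - vec_cond_exp M (HH k) (gh k) \<omega>"

text \<open>The subtracted combination is the mean of \<open>w (Suc k)\<close> given everything
  known before the refresh, so this is the martingale difference of the random choice.\<close>

definition drift :: "nat \<Rightarrow> 'w \<Rightarrow> 'n" where
  "drift k \<omega> = w (Suc k) \<omega> - \<tau> *\<^sub>R w k \<omega> - (1 - \<tau>) *\<^sub>R z (Suc k) \<omega>"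

text \<open>
  Neither \<open>gap_defect\<close> nor \<open>gap_majorant\<close> depends on the comparison point \<open>u\<close>: everything that does is
  either telescoping or paired with \<open>u - z0\<close>.
\<close>

definition gap_defect :: "nat \<Rightarrow> 'w \<Rightarrow> real" where
  "gap_defect k \<omega> =
     ((norm (w (Suc k) \<omega> - z0))\<^sup>2 - \<tau> * (norm (w k \<omega> - z0))\<^sup>2 - (1 - \<tau>) * (norm (z (Suc k) \<omega> - z0))\<^sup>2)
     - 1 / 2 * (norm (z (Suc k) \<omega> - zh k \<omega>))\<^sup>2 - (1 - \<tau>) * (norm (zh k \<omega> - w k \<omega>))\<^sup>2
     + 2 * \<gamma>\<^sup>2 * (norm (gh k \<omega> - g k \<omega>))\<^sup>2 - 2 * \<gamma> * (noise k \<omega> \<bullet> (zh k \<omega> - z0))"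

definition gap_majorant :: "nat \<Rightarrow> 'w \<Rightarrow> real" where
  "gap_majorant K \<omega> = (\<Sum>k<K. gap_defect k \<omega>) + \<gamma>\<^sup>2 * (norm (\<Sum>k<K. noise k \<omega>))\<^sup>2
     + 1 / 4 * (norm (\<Sum>k<K. drift k \<omega>))\<^sup>2"

text \<open>Exhibits the product structure to which independence applies: a centered factor
  depending only on \<open>R k\<close>, times a vector known before the refresh.\<close>

lemma drift_eq:
  assumes "\<omega> \<in> space M"
  shows "drift k \<omega> = (indicator (R k) \<omega> - (1 - \<tau>)) *\<^sub>R (z (Suc k) \<omega> - w k \<omega>)"
  by (cases "\<omega> \<in> R k") (simp_all add: drift_def w_Suc[OF assms] algebra_simps)

section \<open>Pathwise bound on the gap\<close>

text \<open>Monotonicity replaces \<open>F\<close> at the half iterate by \<open>F u\<close>. The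
  noise is split at \<open>z0\<close>: its pairing with \<open>zh k - z0\<close> goes into
  \<open>gap_defect\<close>, its pairing with \<open>u - z0\<close> is kept.\<close>

lemma gap_step:
  assumes mono: "strongly_monotone_on Z F 0" and u: "u \<in> domain_of h"
    and \<omega>: "\<omega> \<in> space M" and unbiased: "vec_cond_exp M (HH k) (gh k) \<omega> = F (zh k \<omega>)"
  shows "2 * \<gamma> * (F u \<bullet> (zh k \<omega> - u) + real_of_ereal (h (zh k \<omega>)) - real_of_ereal (h u))
    \<le> (\<tau> * (norm (z k \<omega> - u))\<^sup>2 + (norm (w k \<omega> - u))\<^sup>2)
      - (\<tau> * (norm (z (Suc k) \<omega> - u))\<^sup>2 + (norm (w (Suc k) \<omega> - u))\<^sup>2)
      + gap_defect k \<omega> + 2 * ((\<gamma> *\<^sub>R noise k \<omega> - drift k \<omega>) \<bullet> (u - z0))"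
proof -
  have Z: "zh k \<omega> \<in> Z" "u \<in> Z" using half_iterate_in_domain[OF \<omega>] u domZ by auto
  have "0 \<le> (F (zh k \<omega>) - F u) \<bullet> (zh k \<omega> - u)"
    using mono Z by (simp add: strongly_monotone_on_def)
  then have "F u \<bullet> (zh k \<omega> - u) \<le> F (zh k \<omega>) \<bullet> (zh k \<omega> - u)"
    by (simp add: inner_diff_left)
  moreover have "gh k \<omega> \<bullet> (zh k \<omega> - u) = F (zh k \<omega>) \<bullet> (zh k \<omega> - u)
      + noise k \<omega> \<bullet> (zh k \<omega> - z0) - noise k \<omega> \<bullet> (u - z0)"
    by (simp add: noise_def unbiased inner_diff_left inner_diff_right)
  ultimately have "2 * \<gamma> * (F u \<bullet> (zh k \<omega> - u) + noise k \<omega> \<bullet> (zh k \<omega> - z0) - noise k \<omega> \<bullet> (u - z0)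
        + real_of_ereal (h (zh k \<omega>)) - real_of_ereal (h u))
      \<le> 2 * \<gamma> * (gh k \<omega> \<bullet> (zh k \<omega> - u) + real_of_ereal (h (zh k \<omega>)) - real_of_ereal (h u))"
    using gamma by (intro mult_left_mono) auto
  then have 1: "2 * \<gamma> * (F u \<bullet> (zh k \<omega> - u) + real_of_ereal (h (zh k \<omega>)) - real_of_ereal (h u))
      + 2 * \<gamma> * (noise k \<omega> \<bullet> (zh k \<omega> - z0)) - 2 * \<gamma> * (noise k \<omega> \<bullet> (u - z0))
      \<le> 2 * \<gamma> * (gh k \<omega> \<bullet> (zh k \<omega> - u) + real_of_ereal (h (zh k \<omega>)) - real_of_ereal (h u))"
    by (simp add: algebra_simps)
  have shift: "(norm (x - u))\<^sup>2 = (norm (x - z0))\<^sup>2 - 2 * ((x - z0) \<bullet> (u - z0)) + (norm (u - z0))\<^sup>2" for x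
    using norm_diff_scaleR_squared[of "x - z0" 1 "u - z0"] by simp
  have "drift k \<omega> = (w (Suc k) \<omega> - z0) - \<tau> *\<^sub>R (w k \<omega> - z0) - (1 - \<tau>) *\<^sub>R (z (Suc k) \<omega> - z0)"
    by (simp add: drift_def algebra_simps)
  then have drift: "drift k \<omega> \<bullet> (u - z0) = (w (Suc k) \<omega> - z0) \<bullet> (u - z0) - \<tau> * ((w k \<omega> - z0) \<bullet> (u - z0))
      - (1 - \<tau>) * ((z (Suc k) \<omega> - z0) \<bullet> (u - z0))"
    by (simp only: inner_diff_left inner_scaleR_left)
  \<comment> \<open>The squares are recentered at \<open>z0\<close>. Their weights 1,
    \<open>- \<tau>\<close> and \<open>- (1 - \<tau>)\<close> add up to zero, so
    \<open>|u - z0|^2\<close> disappears and only a linear term in \<open>u - z0\<close>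
    survives.\<close>
  have 2: "(norm (w (Suc k) \<omega> - u))\<^sup>2 - \<tau> * (norm (w k \<omega> - u))\<^sup>2 - (1 - \<tau>) * (norm (z (Suc k) \<omega> - u))\<^sup>2
     = (norm (w (Suc k) \<omega> - z0))\<^sup>2 - \<tau> * (norm (w k \<omega> - z0))\<^sup>2 - (1 - \<tau>) * (norm (z (Suc k) \<omega> - z0))\<^sup>2
       - 2 * (drift k \<omega> \<bullet> (u - z0))"
    unfolding shift drift by (simp add: algebra_simps)
  have 3: "2 * ((\<gamma> *\<^sub>R noise k \<omega> - drift k \<omega>) \<bullet> (u - z0))
      = 2 * \<gamma> * (noise k \<omega> \<bullet> (u - z0)) - 2 * (drift k \<omega> \<bullet> (u - z0))"
    by (simp add: inner_diff_left)
  have 4: "0 \<le> \<tau> * (norm (z k \<omega> - zh k \<omega>))\<^sup>2" using tau by simp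
  show ?thesis
    using extragradient_step[OF h gamma u zh_eq[OF \<omega>] z_Suc[OF \<omega>], of k] 1 2 4
    unfolding gap_defect_def 3 left_diff_distrib mult_1_left by linarith
qed

lemma gap_sum_bound:
  assumes mono: "strongly_monotone_on Z F 0" and u: "u \<in> domain_of h"
    and \<omega>: "\<omega> \<in> space M" and unbiased: "\<And>k. vec_cond_exp M (HH k) (gh k) \<omega> = F (zh k \<omega>)"
  shows "2 * \<gamma> * (\<Sum>k<K. F u \<bullet> (zh k \<omega> - u) + real_of_ereal (h (zh k \<omega>)) - real_of_ereal (h u))
    \<le> 7 * (norm (z0 - u))\<^sup>2 + gap_majorant K \<omega>"
proof -
  define P where "P = (\<lambda>k. \<tau> * (norm (z k \<omega> - u))\<^sup>2 + (norm (w k \<omega> - u))\<^sup>2)"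
  define v where "v = u - z0"
  have "2 * \<gamma> * (\<Sum>k<K. F u \<bullet> (zh k \<omega> - u) + real_of_ereal (h (zh k \<omega>)) - real_of_ereal (h u))
      \<le> (\<Sum>k<K. P k - P (Suc k) + gap_defect k \<omega> + 2 * ((\<gamma> *\<^sub>R noise k \<omega> - drift k \<omega>) \<bullet> v))"
    unfolding sum_distrib_left P_def v_def by (intro sum_mono gap_step[OF mono u \<omega> unbiased])
  also have "\<dots> = P 0 - P K + (\<Sum>k<K. gap_defect k \<omega>)
      + 2 * ((\<gamma> *\<^sub>R (\<Sum>k<K. noise k \<omega>) - (\<Sum>k<K. drift k \<omega>)) \<bullet> v)"
  proof -
    have "(\<Sum>k<K. 2 * ((\<gamma> *\<^sub>R noise k \<omega> - drift k \<omega>) \<bullet> v))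
        = 2 * ((\<gamma> *\<^sub>R (\<Sum>k<K. noise k \<omega>) - (\<Sum>k<K. drift k \<omega>)) \<bullet> v)"
      by (simp add: sum_distrib_left[symmetric] inner_sum_left[symmetric] scaleR_sum_right sum_subtractf)
    then show ?thesis
      unfolding sum.distrib sum_lessThan_telescope' by simp
  qed
  finally have 1: "2 * \<gamma> * (\<Sum>k<K. F u \<bullet> (zh k \<omega> - u) + real_of_ereal (h (zh k \<omega>)) - real_of_ereal (h u))
      \<le> P 0 - P K + (\<Sum>k<K. gap_defect k \<omega>)
      + 2 * ((\<gamma> *\<^sub>R (\<Sum>k<K. noise k \<omega>) - (\<Sum>k<K. drift k \<omega>)) \<bullet> v)" .
  have P0: "P 0 \<le> 2 * (norm v)\<^sup>2"
    using tau by (simp add: P_def z_0[OF \<omega>] w_0[OF \<omega>] v_def norm_minus_commute mult_left_le_one_le)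
  have PK: "0 \<le> P K" using tau by (simp add: P_def)
  \<comment> \<open>The constant 7 is 2 from \<open>P 0\<close>, 1 from Young's inequality for the
    noise and 4 from that for the drift. The large weight 4 reduces the squared drift to the factor
    \<open>1 / 4\<close> with which the negative terms can absorb it.\<close>
  have n: "2 * (\<gamma> *\<^sub>R (\<Sum>k<K. noise k \<omega>) \<bullet> v) \<le> \<gamma>\<^sup>2 * (norm (\<Sum>k<K. noise k \<omega>))\<^sup>2 + (norm v)\<^sup>2"
    using zero_le_power2[of "norm (v - \<gamma> *\<^sub>R (\<Sum>k<K. noise k \<omega>))"]
    unfolding norm_diff_scaleR_squared by (simp add: inner_commute)
  have d: "- 2 * ((\<Sum>k<K. drift k \<omega>) \<bullet> v) \<le> 1 / 4 * (norm (\<Sum>k<K. drift k \<omega>))\<^sup>2 + 4 * (norm v)\<^sup>2"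
    using zero_le_power2[of "norm ((\<Sum>k<K. drift k \<omega>) - (- 4) *\<^sub>R v)"]
    unfolding norm_diff_scaleR_squared by simp
  have nv: "norm v = norm (z0 - u)" by (simp add: v_def norm_minus_commute)
  have "2 * ((\<gamma> *\<^sub>R (\<Sum>k<K. noise k \<omega>) - (\<Sum>k<K. drift k \<omega>)) \<bullet> v)
      = 2 * (\<gamma> *\<^sub>R (\<Sum>k<K. noise k \<omega>) \<bullet> v) + - 2 * ((\<Sum>k<K. drift k \<omega>) \<bullet> v)"
    by (simp add: inner_diff_left)
  also have "\<dots> \<le> (\<gamma>\<^sup>2 * (norm (\<Sum>k<K. noise k \<omega>))\<^sup>2 + (norm v)\<^sup>2)
      + (1 / 4 * (norm (\<Sum>k<K. drift k \<omega>))\<^sup>2 + 4 * (norm v)\<^sup>2)"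
    by (rule add_mono[OF n d])
  finally show ?thesis
    using 1 P0 PK unfolding gap_majorant_def nv by (elim order_trans) simp
qed

lemma convex_on_domain: "convex_on (domain_of h) (\<lambda>x. real_of_ereal (h x))"
proof -
  have *: "h (a *\<^sub>R x + b *\<^sub>R y) \<le> ereal (a * real_of_ereal (h x) + b * real_of_ereal (h y))"
    if "x \<in> domain_of h" "y \<in> domain_of h" "0 \<le> a" "0 \<le> b" "a + b = 1" for x y a b
  proof -
    have "h (a *\<^sub>R x + b *\<^sub>R y) \<le> ereal a * h x + ereal b * h y"
      using h(3) that unfolding convex_fun_def by blast
    also have "\<dots> = ereal (a * real_of_ereal (h x) + b * real_of_ereal (h y))"
      by (subst (1 2) domain_finite) (simp_all add: that)
    finally show ?thesis .
  qed
  have dom: "a *\<^sub>R x + b *\<^sub>R y \<in> domain_of h"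
    if "x \<in> domain_of h" "y \<in> domain_of h" "0 \<le> a" "0 \<le> b" "a + b = 1" for x y a b
    using le_less_trans[OF *[OF that], of \<infinity>] by (simp add: domain_of_def)
  show ?thesis
    unfolding convex_on_def
  proof (intro conjI ballI allI impI)
    show "convex (domain_of h)" unfolding convex_def using dom by blast
    fix x y and a b :: real
    assume A: "x \<in> domain_of h" "y \<in> domain_of h" "0 \<le> a" "0 \<le> b" "a + b = 1"
    show "real_of_ereal (h (a *\<^sub>R x + b *\<^sub>R y)) \<le> a * real_of_ereal (h x) + b * real_of_ereal (h y)"
      using *[OF A] domain_finite[OF dom[OF A]] by (metis ereal_less_eq(3))
  qed
qed

lemma average_in_domain:
  assumes "1 \<le> K" "\<omega> \<in> space M"
  shows "(1 / real K) *\<^sub>R (\<Sum>k<K. zh k \<omega>) \<in> domain_of h"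
  unfolding scaleR_sum_right using assms(1) convex_on_domain half_iterate_in_domain[OF assms(2)]
  by (intro convex_sum) (auto simp: convex_on_def)

text \<open>Jensen's inequality handles \<open>h\<close> and linearity handles the pairing with
  \<open>F u\<close>. For \<open>u\<close> outside the domain of \<open>h\<close> the term in the
  supremum is \<open>-\<infinity>\<close>, so the pathwise bound is needed only inside it.\<close>

lemma gap_average_bound:
  assumes mono: "strongly_monotone_on Z F 0" and K: "1 \<le> K"
    and \<omega>: "\<omega> \<in> space M" and unbiased: "\<And>k. vec_cond_exp M (HH k) (gh k) \<omega> = F (zh k \<omega>)"
    and \<Delta>: "\<And>u. u \<in> U \<Longrightarrow> (norm (z0 - u))\<^sup>2 \<le> \<Delta>"
  shows "gap U F h ((1 / real K) *\<^sub>R (\<Sum>k<K. zh k \<omega>)) \<le> ereal ((7 * \<Delta> + gap_majorant K \<omega>) / (2 * \<gamma> * real K))"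
  unfolding gap_def
proof (rule SUP_least)
  define zb where "zb = (1 / real K) *\<^sub>R (\<Sum>k<K. zh k \<omega>)"
  have zb: "zb = (\<Sum>k<K. (1 / real K) *\<^sub>R zh k \<omega>)" by (simp add: zb_def scaleR_sum_right)
  have "zb \<in> domain_of h"
    unfolding zb_def by (rule average_in_domain[OF K \<omega>])
  then obtain a where a: "h zb = ereal a" using domain_finite by metis
  have "real_of_ereal (h zb) \<le> (\<Sum>k<K. (1 / real K) * real_of_ereal (h (zh k \<omega>)))"
    unfolding zb using K half_iterate_in_domain[OF \<omega>]
    by (intro convex_on_sum[OF _ _ convex_on_domain]) (auto simp: lessThan_empty_iff)
  also have "\<dots> = (\<Sum>k<K. real_of_ereal (h (zh k \<omega>))) / real K"
    by (simp add: sum_divide_distrib)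
  finally have "real_of_ereal (h zb) \<le> (\<Sum>k<K. real_of_ereal (h (zh k \<omega>))) / real K" .
  then have jensen: "real K * a \<le> (\<Sum>k<K. real_of_ereal (h (zh k \<omega>)))"
    using K by (simp add: a field_simps)
  fix u assume u: "u \<in> U"
  show "ereal (F u \<bullet> (zb - u)) + h zb - h u \<le> ereal ((7 * \<Delta> + gap_majorant K \<omega>) / (2 * \<gamma> * real K))"
  proof (cases "u \<in> domain_of h")
    case True
    then obtain b where b: "h u = ereal b" using domain_finite by metis
    have "real K * (F u \<bullet> (zb - u)) = (\<Sum>k<K. F u \<bullet> (zh k \<omega> - u))"
      using K by (simp add: zb_def inner_diff_right sum_subtractf inner_sum_right algebra_simps)
    with jensen have "real K * (F u \<bullet> (zb - u) + a - b)
        \<le> (\<Sum>k<K. F u \<bullet> (zh k \<omega> - u) + real_of_ereal (h (zh k \<omega>)) - real_of_ereal (h u))"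
      by (simp add: b sum.distrib sum_subtractf algebra_simps)
    then have "2 * \<gamma> * (real K * (F u \<bullet> (zb - u) + a - b))
        \<le> 2 * \<gamma> * (\<Sum>k<K. F u \<bullet> (zh k \<omega> - u) + real_of_ereal (h (zh k \<omega>)) - real_of_ereal (h u))"
      using gamma by (intro mult_left_mono) auto
    also have "\<dots> \<le> 7 * \<Delta> + gap_majorant K \<omega>"
      using gap_sum_bound[OF mono True \<omega> unbiased, of K] \<Delta>[OF u] by linarith
    finally have "F u \<bullet> (zb - u) + a - b \<le> (7 * \<Delta> + gap_majorant K \<omega>) / (2 * \<gamma> * real K)"
      using gamma K by (simp add: field_simps)
    then show ?thesis by (simp add: a b)
  next
    case False
    then have "h u = \<infinity>" by (simp add: domain_of_def)
    then show ?thesis by (simp add: a)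
  qed
qed

end

lemma geometric_noise_sum_bound:
  fixes s d :: "nat \<Rightarrow> real"
  assumes "\<And>k. s (Suc k) \<le> (1 - \<rho>) * s k + C * d k + D" "\<And>k. 0 \<le> s k"
  shows "\<rho> * (\<Sum>k<K. s k) \<le> s 0 + C * (\<Sum>k<K. d k) + real K * D"
proof -
  \<comment> \<open>The summed recursion telescopes only if the last term \<open>s K\<close> is kept
    on the left; it is dropped afterwards by nonnegativity.\<close>
  have "\<rho> * (\<Sum>k<K. s k) + s K \<le> s 0 + C * (\<Sum>k<K. d k) + real K * D"
  proof (induction K)
    case (Suc K)
    with assms(1)[of K] show ?case by (simp add: algebra_simps)
  qed simp
  with assms(2)[of K] show ?thesis by linarith
qed

context stochastic_extragradient
begin

section \<open>Orthogonality and second moments of noise and drift\<close>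

lemma drift_measurable [measurable]: "drift k \<in> borel_measurable M"
  unfolding drift_def[abs_def] by measurable

lemma drift_square_integrable: "square_integrable M (drift k)"
proof (rule square_integrable_bound)
  show "square_integrable M (\<lambda>\<omega>. z (Suc k) \<omega> - w k \<omega>)"
    by (intro square_integrable_diff square_integrable_iterates)
  show "norm (drift k \<omega>) \<le> 1 * norm (z (Suc k) \<omega> - w k \<omega>)" if "\<omega> \<in> space M" for \<omega>
    unfolding drift_eq[OF that] norm_scaleR using tau
    by (intro mult_right_mono) (auto simp: indicator_def)
qed measurable

lemma centered_indicator_expectation:
  fixes X :: "'w \<Rightarrow> real"
  assumes "X \<in> borel_measurable (HF k)" "integrable M X"
  shows "(\<integral>\<omega>. (indicator (R k) \<omega> - (1 - \<tau>)) * X \<omega> \<partial>M) = 0"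
    and "integrable M (\<lambda>\<omega>. (indicator (R k) \<omega> - (1 - \<tau>)) * X \<omega>)"
proof -
  have int: "integrable M (\<lambda>\<omega>. indicator (R k) \<omega> * X \<omega>)"
    using integrable_mult_indicator[OF R_meas assms(2)] by simp
  then show "integrable M (\<lambda>\<omega>. (indicator (R k) \<omega> - (1 - \<tau>)) * X \<omega>)"
    unfolding left_diff_distrib[of "indicator _ _"]
    by (intro Bochner_Integration.integrable_diff integrable_mult_right assms)
  show "(\<integral>\<omega>. (indicator (R k) \<omega> - (1 - \<tau>)) * X \<omega> \<partial>M) = 0"
    unfolding left_diff_distrib[of "indicator _ _"]
    using integral_indicator_mult_indep[OF subalgebra_history_full indep_R R_meas assms] int assms(2)
    by (simp add: prob_R)
qed

text \<open>Since \<open>Suc j \<le> k\<close>, the earlier \<open>drift j\<close> is known before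
  \<open>R k\<close> is drawn; it joins the measurable factor, and the centered indicator of
  \<open>R k\<close> integrates to zero against it.\<close>

lemma drift_orthogonal:
  assumes "j < k"
  shows "(\<integral>\<omega>. drift j \<omega> \<bullet> drift k \<omega> \<partial>M) = 0"
proof -
  have [measurable]: "z (Suc k) \<in> borel_measurable (HF k)" "w k \<in> borel_measurable (HF k)"
    "z (Suc j) \<in> borel_measurable (HF k)" "w j \<in> borel_measurable (HF k)" "w (Suc j) \<in> borel_measurable (HF k)"
    using assms by (simp_all add: iterates_measurable_history)
  have "(\<lambda>\<omega>. drift j \<omega> \<bullet> (z (Suc k) \<omega> - w k \<omega>)) \<in> borel_measurable (HF k)"
    unfolding drift_def by measurable
  moreover have "integrable M (\<lambda>\<omega>. drift j \<omega> \<bullet> (z (Suc k) \<omega> - w k \<omega>))"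
    by (intro square_integrable_inner drift_square_integrable square_integrable_diff square_integrable_iterates)
  ultimately have "(\<integral>\<omega>. (indicator (R k) \<omega> - (1 - \<tau>)) * (drift j \<omega> \<bullet> (z (Suc k) \<omega> - w k \<omega>)) \<partial>M) = 0"
    by (rule centered_indicator_expectation)
  moreover have "(\<integral>\<omega>. drift j \<omega> \<bullet> drift k \<omega> \<partial>M)
      = (\<integral>\<omega>. (indicator (R k) \<omega> - (1 - \<tau>)) * (drift j \<omega> \<bullet> (z (Suc k) \<omega> - w k \<omega>)) \<partial>M)"
    by (rule Bochner_Integration.integral_cong) (simp_all add: drift_eq[of _ k])
  ultimately show ?thesis by simp
qed

lemma drift_second_moment:
  "(\<integral>\<omega>. (norm (drift k \<omega>))\<^sup>2 \<partial>M) = \<tau> * (1 - \<tau>) * (\<integral>\<omega>. (norm (z (Suc k) \<omega> - w k \<omega>))\<^sup>2 \<partial>M)"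
proof -
  let ?Y = "\<lambda>\<omega>. (norm (z (Suc k) \<omega> - w k \<omega>))\<^sup>2"
  have [measurable]: "z (Suc k) \<in> borel_measurable (HF k)" "w k \<in> borel_measurable (HF k)"
    by (simp_all add: iterates_measurable_history)
  have Y: "?Y \<in> borel_measurable (HF k)" by measurable
  have iY: "integrable M ?Y"
    by (intro square_integrable_norm square_integrable_diff square_integrable_iterates)
  note c = centered_indicator_expectation[OF Y iY]
  define Q where "Q = (\<lambda>\<omega>. (indicator (R k) \<omega> - (1 - \<tau>)) * ?Y \<omega>)"
  have "(\<integral>\<omega>. (norm (drift k \<omega>))\<^sup>2 \<partial>M) = (\<integral>\<omega>. (2 * \<tau> - 1) * Q \<omega> + \<tau> * (1 - \<tau>) * ?Y \<omega> \<partial>M)"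
  proof (rule Bochner_Integration.integral_cong[OF refl])
    fix \<omega> assume \<omega>: "\<omega> \<in> space M"
    have "(norm (drift k \<omega>))\<^sup>2 = (indicator (R k) \<omega> - (1 - \<tau>))\<^sup>2 * ?Y \<omega>"
      unfolding drift_eq[OF \<omega>] norm_scaleR power_mult_distrib power2_abs ..
    \<comment> \<open>An indicator is idempotent, so its centered square is affine in it: the
      Bernoulli variance \<open>\<tau> (1 - \<tau>)\<close> plus a mean-zero part.\<close>
    also have "(indicator (R k) \<omega> - (1 - \<tau>))\<^sup>2 = (2 * \<tau> - 1) * (indicator (R k) \<omega> - (1 - \<tau>)) + \<tau> * (1 - \<tau>)"
      by (cases "\<omega> \<in> R k") (simp_all add: algebra_simps power2_eq_square)
    finally show "(norm (drift k \<omega>))\<^sup>2 = (2 * \<tau> - 1) * Q \<omega> + \<tau> * (1 - \<tau>) * ?Y \<omega>"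
      by (simp only: Q_def distrib_right mult.assoc)
  qed
  also have "\<dots> = (\<integral>\<omega>. (2 * \<tau> - 1) * Q \<omega> \<partial>M) + (\<integral>\<omega>. \<tau> * (1 - \<tau>) * ?Y \<omega> \<partial>M)"
    using c(2)[folded Q_def] iY by (intro Bochner_Integration.integral_add integrable_mult_right)
  also have "\<dots> = \<tau> * (1 - \<tau>) * (\<integral>\<omega>. ?Y \<omega> \<partial>M)"
    using c(1)[folded Q_def] by simp
  finally show ?thesis .
qed

lemma noise_eq: "noise k = (\<lambda>\<omega>. gh k \<omega> - vec_cond_exp M (HH k) (gh k) \<omega>)"
  by (simp add: fun_eq_iff noise_def)

lemma noise_square_integrable:
  assumes "AE \<omega> in M. vec_cond_exp M (HH k) (gh k) \<omega> = F (zh k \<omega>)"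
  shows "square_integrable M (noise k)"
    and "(\<integral>\<omega>. (norm (noise k \<omega>))\<^sup>2 \<partial>M) = (\<integral>\<omega>. (norm (gh k \<omega> - F (zh k \<omega>)))\<^sup>2 \<partial>M)"
  unfolding noise_eq by (rule residual_square_integrable[OF subalgebra_history_half assms])+

lemma noise_orthogonal_history:
  assumes "AE \<omega> in M. vec_cond_exp M (HH k) (gh k) \<omega> = F (zh k \<omega>)"
    and "f \<in> borel_measurable (HH k)" "square_integrable M f"
  shows "(\<integral>\<omega>. noise k \<omega> \<bullet> f \<omega> \<partial>M) = 0"
  using noise_square_integrable(1)[OF assms(1)] unfolding noise_eq
  by (rule cond_exp_residual_orthogonal[OF subalgebra_history_half gh_int assms(2,3)])

text \<open>The strict inequality matters: \<open>gh j\<close> enters the half-step history only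
  from index \<open>j + 1\<close> on. With \<open>noise_orthogonal_history\<close> this gives
  pairwise orthogonality.\<close>

lemma noise_history_measurable:
  assumes "j < k"
  shows "noise j \<in> borel_measurable (HH k)"
proof -
  have [measurable]: "vec_cond_exp M (HH j) (gh j) \<in> borel_measurable (HH k)"
    using assms by (intro measurable_from_subalg[OF history_half_mono vec_cond_exp_borel_measurable]) simp
  have [measurable]: "gh j \<in> borel_measurable (HH k)" using assms by (rule history_half_measurable)
  show ?thesis unfolding noise_def[abs_def] by measurable
qed

text \<open>Orthogonality turns the squared sums into sums of second moments, and in each step the
  drift is paid from the negative terms. Half of \<open>(1 - \<tau>) |zh k - w k|^2\<close> remains
  for the variance of the estimators.\<close>

lemma gap_majorant_expectation:
  assumes ae: "\<And>k. AE \<omega> in M. vec_cond_exp M (HH k) (gh k) \<omega> = F (zh k \<omega>)"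
  shows "integrable M (gap_majorant K)"
    and "(\<integral>\<omega>. gap_majorant K \<omega> \<partial>M)
      \<le> (\<Sum>k<K. 2 * \<gamma>\<^sup>2 * (\<integral>\<omega>. (norm (gh k \<omega> - g k \<omega>))\<^sup>2 \<partial>M)
            + \<gamma>\<^sup>2 * (\<integral>\<omega>. (norm (gh k \<omega> - F (zh k \<omega>)))\<^sup>2 \<partial>M)
            - (1 - \<tau>) / 2 * (\<integral>\<omega>. (norm (zh k \<omega> - w k \<omega>))\<^sup>2 \<partial>M))"
proof -
  note si = noise_square_integrable(1)[OF ae]
  note ints = shifted_square_integrable[THEN square_integrable_norm] diff_int dist_int
    square_integrable_norm[OF square_integrable_correction]
    square_integrable_inner[OF si shifted_square_integrable(3)]
  have idef: "integrable M (gap_defect k)" for k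
    unfolding gap_defect_def[abs_def]
    by (intro Bochner_Integration.integrable_add Bochner_Integration.integrable_diff integrable_mult_right ints)
  have isum: "integrable M (\<lambda>\<omega>. \<Sum>k<K. gap_defect k \<omega>)" "integrable M (\<lambda>\<omega>. (norm (\<Sum>k<K. noise k \<omega>))\<^sup>2)"
    "integrable M (\<lambda>\<omega>. (norm (\<Sum>k<K. drift k \<omega>))\<^sup>2)"
    by (intro Bochner_Integration.integrable_sum idef square_integrable_norm square_integrable_sum si
        drift_square_integrable)+
  then show "integrable M (gap_majorant K)"
    unfolding gap_majorant_def[abs_def]
    by (intro Bochner_Integration.integrable_add integrable_mult_right)
  have noise: "(\<integral>\<omega>. (norm (\<Sum>k<K. noise k \<omega>))\<^sup>2 \<partial>M) = (\<Sum>k<K. \<integral>\<omega>. (norm (gh k \<omega> - F (zh k \<omega>)))\<^sup>2 \<partial>M)"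
    using noise_orthogonal_history[OF ae noise_history_measurable si]
    by (subst square_integrable_orthogonal_sum[OF si]) (simp_all add: inner_commute noise_square_integrable(2)[OF ae])
  have drift: "(\<integral>\<omega>. (norm (\<Sum>k<K. drift k \<omega>))\<^sup>2 \<partial>M)
      = (\<Sum>k<K. \<tau> * (1 - \<tau>) * (\<integral>\<omega>. (norm (z (Suc k) \<omega> - w k \<omega>))\<^sup>2 \<partial>M))"
    by (subst square_integrable_orthogonal_sum[OF drift_square_integrable drift_orthogonal])
      (simp_all add: drift_second_moment)
  have defect: "(\<integral>\<omega>. gap_defect k \<omega> \<partial>M) = - (1 / 2) * (\<integral>\<omega>. (norm (z (Suc k) \<omega> - zh k \<omega>))\<^sup>2 \<partial>M)
      - (1 - \<tau>) * (\<integral>\<omega>. (norm (zh k \<omega> - w k \<omega>))\<^sup>2 \<partial>M) + 2 * \<gamma>\<^sup>2 * (\<integral>\<omega>. (norm (gh k \<omega> - g k \<omega>))\<^sup>2 \<partial>M)" for k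
  proof -
    have "(\<integral>\<omega>. noise k \<omega> \<bullet> (zh k \<omega> - z0) \<partial>M) = 0"
    proof (rule noise_orthogonal_history[OF ae])
      show "(\<lambda>\<omega>. zh k \<omega> - z0) \<in> borel_measurable (HH k)"
        using half_iterate_measurable_history[of k] by measurable
    qed (rule shifted_square_integrable)
    moreover have "(\<integral>\<omega>. (norm (w (Suc k) \<omega> - z0))\<^sup>2 \<partial>M)
      = (1 - \<tau>) * (\<integral>\<omega>. (norm (z (Suc k) \<omega> - z0))\<^sup>2 \<partial>M) + \<tau> * (\<integral>\<omega>. (norm (w k \<omega> - z0))\<^sup>2 \<partial>M)"
      by (rule refresh_expectation) (simp_all add: ints)
    ultimately show ?thesis
      unfolding gap_defect_def by (simp add: ints)
  qed
  \<comment> \<open>Splitting \<open>z (Suc k) - w k\<close> at the half iterate costs a factor 2;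
    with \<open>1 / 4\<close> this uses the whole reserve \<open>1/2 |z (Suc k) - zh k|^2\<close>
    and half of the other negative term.\<close>
  have corr: "1 / 4 * (\<tau> * (1 - \<tau>) * (\<integral>\<omega>. (norm (z (Suc k) \<omega> - w k \<omega>))\<^sup>2 \<partial>M))
      \<le> 1 / 2 * (\<integral>\<omega>. (norm (z (Suc k) \<omega> - zh k \<omega>))\<^sup>2 \<partial>M) + (1 - \<tau>) / 2 * (\<integral>\<omega>. (norm (zh k \<omega> - w k \<omega>))\<^sup>2 \<partial>M)" for k
  proof -
    let ?p = "\<integral>\<omega>. (norm (z (Suc k) \<omega> - zh k \<omega>))\<^sup>2 \<partial>M" and ?d = "\<integral>\<omega>. (norm (zh k \<omega> - w k \<omega>))\<^sup>2 \<partial>M"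
    have "(\<integral>\<omega>. (norm (z (Suc k) \<omega> - w k \<omega>))\<^sup>2 \<partial>M)
        \<le> (\<integral>\<omega>. 2 * (norm (z (Suc k) \<omega> - zh k \<omega>))\<^sup>2 + 2 * (norm (zh k \<omega> - w k \<omega>))\<^sup>2 \<partial>M)"
      by (intro integral_mono Bochner_Integration.integrable_add integrable_mult_right ints norm_diff_power2_le
          square_integrable_norm square_integrable_diff square_integrable_iterates)
    also have "\<dots> = 2 * ?p + 2 * ?d" by (simp add: ints)
    finally have "\<tau> * (1 - \<tau>) * (\<integral>\<omega>. (norm (z (Suc k) \<omega> - w k \<omega>))\<^sup>2 \<partial>M) \<le> \<tau> * (1 - \<tau>) * (2 * ?p + 2 * ?d)"
      using tau by (intro mult_left_mono) auto
    also have "\<dots> \<le> (1 - \<tau>) * (2 * ?p + 2 * ?d)"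
      using tau by (intro mult_right_mono mult_left_le_one_le add_nonneg_nonneg) auto
    also have "\<dots> = 2 * ((1 - \<tau>) * ?p) + 2 * ((1 - \<tau>) * ?d)" by (simp add: algebra_simps)
    also have "(1 - \<tau>) * ?p \<le> ?p" using tau by (intro mult_left_le_one_le) auto
    finally show ?thesis by simp
  qed
  have "(\<integral>\<omega>. gap_majorant K \<omega> \<partial>M) = (\<Sum>k<K. \<integral>\<omega>. gap_defect k \<omega> \<partial>M)
      + \<gamma>\<^sup>2 * (\<Sum>k<K. \<integral>\<omega>. (norm (gh k \<omega> - F (zh k \<omega>)))\<^sup>2 \<partial>M)
      + 1 / 4 * (\<Sum>k<K. \<tau> * (1 - \<tau>) * (\<integral>\<omega>. (norm (z (Suc k) \<omega> - w k \<omega>))\<^sup>2 \<partial>M))"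
    unfolding gap_majorant_def noise[symmetric] drift[symmetric] using isum idef
    by (simp add: Bochner_Integration.integral_sum)
  also have "\<dots> = (\<Sum>k<K. (\<integral>\<omega>. gap_defect k \<omega> \<partial>M) + \<gamma>\<^sup>2 * (\<integral>\<omega>. (norm (gh k \<omega> - F (zh k \<omega>)))\<^sup>2 \<partial>M)
      + 1 / 4 * (\<tau> * (1 - \<tau>) * (\<integral>\<omega>. (norm (z (Suc k) \<omega> - w k \<omega>))\<^sup>2 \<partial>M)))"
    by (simp only: sum.distrib sum_distrib_left)
  also have "\<dots> \<le> (\<Sum>k<K. 2 * \<gamma>\<^sup>2 * (\<integral>\<omega>. (norm (gh k \<omega> - g k \<omega>))\<^sup>2 \<partial>M)
            + \<gamma>\<^sup>2 * (\<integral>\<omega>. (norm (gh k \<omega> - F (zh k \<omega>)))\<^sup>2 \<partial>M)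
            - (1 - \<tau>) / 2 * (\<integral>\<omega>. (norm (zh k \<omega> - w k \<omega>))\<^sup>2 \<partial>M))"
  proof (rule sum_mono)
    fix k
    show "(\<integral>\<omega>. gap_defect k \<omega> \<partial>M) + \<gamma>\<^sup>2 * (\<integral>\<omega>. (norm (gh k \<omega> - F (zh k \<omega>)))\<^sup>2 \<partial>M)
      + 1 / 4 * (\<tau> * (1 - \<tau>) * (\<integral>\<omega>. (norm (z (Suc k) \<omega> - w k \<omega>))\<^sup>2 \<partial>M))
      \<le> 2 * \<gamma>\<^sup>2 * (\<integral>\<omega>. (norm (gh k \<omega> - g k \<omega>))\<^sup>2 \<partial>M)
            + \<gamma>\<^sup>2 * (\<integral>\<omega>. (norm (gh k \<omega> - F (zh k \<omega>)))\<^sup>2 \<partial>M)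
            - (1 - \<tau>) / 2 * (\<integral>\<omega>. (norm (zh k \<omega> - w k \<omega>))\<^sup>2 \<partial>M)"
      using corr[of k] unfolding defect by (simp add: field_simps)
  qed
  finally show "(\<integral>\<omega>. gap_majorant K \<omega> \<partial>M)
      \<le> (\<Sum>k<K. 2 * \<gamma>\<^sup>2 * (\<integral>\<omega>. (norm (gh k \<omega> - g k \<omega>))\<^sup>2 \<partial>M)
            + \<gamma>\<^sup>2 * (\<integral>\<omega>. (norm (gh k \<omega> - F (zh k \<omega>)))\<^sup>2 \<partial>M)
            - (1 - \<tau>) / 2 * (\<integral>\<omega>. (norm (zh k \<omega> - w k \<omega>))\<^sup>2 \<partial>M))" .
qed

end

section \<open>The ergodic rate\<close>

text \<open>The gap is a supremum over possibly uncountably many \<open>u\<close> with an arbitrary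
  \<open>F\<close>, so it is never integrated directly: it is dominated by the integrable
  \<open>Y\<close>, and monotonicity of the nonnegative integral does not ask for its
  measurability.\<close>

lemma (in stochastic_extragradient) ergodic_gap_bound:
  assumes sig: "\<And>k. integrable M (\<lambda>\<omega>. (\<sigma> k \<omega>)\<^sup>2)" and sig0: "\<And>\<omega>. \<omega> \<in> space M \<Longrightarrow> \<sigma> 0 \<omega> = \<sigma>0"
    and ae: "\<And>k. AE \<omega> in M. vec_cond_exp M (HH k) (gh k) \<omega> = F (zh k \<omega>)"
    and nonneg: "0 \<le> D1" "0 \<le> D2" "0 \<le> D3" "0 < T"
    and e: "\<And>k. (\<integral>\<omega>. (norm (gh k \<omega> - g k \<omega>))\<^sup>2 \<partial>M)
           \<le> A * (\<integral>\<omega>. (norm (zh k \<omega> - w k \<omega>))\<^sup>2 \<partial>M) + B * (\<integral>\<omega>. (\<sigma> k \<omega>)\<^sup>2 \<partial>M) + D1"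
    and s: "\<And>k. (\<integral>\<omega>. (\<sigma> (Suc k) \<omega>)\<^sup>2 \<partial>M)
           \<le> (1 - \<rho>) * (\<integral>\<omega>. (\<sigma> k \<omega>)\<^sup>2 \<partial>M) + C * (\<integral>\<omega>. (norm (zh k \<omega> - w k \<omega>))\<^sup>2 \<partial>M) + D2"
    and n: "\<And>k. (\<integral>\<omega>. (norm (gh k \<omega> - F (zh k \<omega>)))\<^sup>2 \<partial>M)
           \<le> E * (\<integral>\<omega>. (norm (zh k \<omega> - w k \<omega>))\<^sup>2 \<partial>M) + D3"
    and mono: "strongly_monotone_on Z F 0" and U: "compact U" "zs \<in> U" and K: "1 \<le> K"
    and step: "4 * \<gamma>\<^sup>2 * (2 * A + T * C + E) \<le> 1 - \<tau>" "2 * B \<le> T * \<rho>"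
  shows "(\<integral>\<^sup>+\<omega>. e2ennreal (gap U F h ((1 / real K) *\<^sub>R (\<Sum>k<K. zh k \<omega>))) \<partial>M)
        \<le> ennreal
            ((8 * (SUP u\<in>U. (norm (z0 - u))\<^sup>2) + 4 * \<gamma>\<^sup>2 * T * \<sigma>0\<^sup>2) / (\<gamma> * real K)
             + \<gamma> * (7 * D1 + 3 * T * D2 + D3))"
proof -
  define \<Delta> where "\<Delta> = (SUP u\<in>U. (norm (z0 - u))\<^sup>2)"
  have "compact ((\<lambda>u. (norm (z0 - u))\<^sup>2) ` U)"
    by (intro compact_continuous_image continuous_intros U)
  then have bdd: "bdd_above ((\<lambda>u. (norm (z0 - u))\<^sup>2) ` U)"
    by (intro bounded_imp_bdd_above compact_imp_bounded)
  have \<Delta>: "(norm (z0 - u))\<^sup>2 \<le> \<Delta>" if "u \<in> U" for u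
    unfolding \<Delta>_def by (rule cSUP_upper[OF that bdd])
  have \<Delta>0: "0 \<le> \<Delta>" using \<Delta>[OF U(2)] by (rule order_trans[OF zero_le_power2])
  define Y where "Y = (\<lambda>\<omega>. (7 * \<Delta> + gap_majorant K \<omega>) / (2 * \<gamma> * real K))"
  let ?zb = "\<lambda>\<omega>. (1 / real K) *\<^sub>R (\<Sum>k<K. zh k \<omega>)"
  \<comment> \<open>One null set covers all steps and is fixed before \<open>u\<close> is chosen, so
    the supremum over \<open>u\<close> adds no exceptional sets.\<close>
  have AE_all: "AE \<omega> in M. \<forall>k. vec_cond_exp M (HH k) (gh k) \<omega> = F (zh k \<omega>)"
    using ae by (simp add: AE_all_countable)
  have gap_le: "AE \<omega> in M. gap U F h (?zb \<omega>) \<le> ereal (Y \<omega>)"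
    using AE_all AE_space
  proof eventually_elim
    case (elim \<omega>)
    then show ?case
      unfolding Y_def by (intro gap_average_bound[OF mono K] \<Delta>) auto
  qed
  have gap_ge: "0 \<le> gap U F h (?zb \<omega>)" if "\<omega> \<in> space M" for \<omega>
  proof -
    have "?zb \<omega> \<in> Z" using average_in_domain[OF K that] domZ by auto
    then have "0 \<le> ereal (F zs \<bullet> (?zb \<omega> - zs)) + h (?zb \<omega>) - h zs"
      using zs by (simp add: vi_solution_def)
    also have "\<dots> \<le> gap U F h (?zb \<omega>)"
      unfolding gap_def by (rule SUP_upper[OF U(2)])
    finally show ?thesis .
  qed
  have Y0: "AE \<omega> in M. 0 \<le> Y \<omega>"
    using gap_le AE_space
  proof eventually_elim
    case (elim \<omega>)
    with gap_ge[of \<omega>] have "0 \<le> ereal (Y \<omega>)" by (meson order_trans)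
    then show ?case by simp
  qed
  have iY: "integrable M Y"
    unfolding Y_def using gap_majorant_expectation(1)[OF ae] by simp
  define d where "d = (\<lambda>k. \<integral>\<omega>. (norm (zh k \<omega> - w k \<omega>))\<^sup>2 \<partial>M)"
  define S where "S = (\<lambda>k. \<integral>\<omega>. (\<sigma> k \<omega>)\<^sup>2 \<partial>M)"
  define ds where "ds = (\<Sum>k<K. d k)"
  have ds0: "0 \<le> ds" by (auto simp: ds_def d_def intro!: sum_nonneg)
  have S0: "S 0 = \<sigma>0\<^sup>2"
  proof -
    have "S 0 = (\<integral>\<omega>. \<sigma>0\<^sup>2 \<partial>M)"
      unfolding S_def by (rule Bochner_Integration.integral_cong) (simp_all add: sig0)
    then show ?thesis by (simp add: prob_space)
  qed
  have G: "0 \<le> \<gamma>\<^sup>2" by simp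
  have "\<rho> * (\<Sum>k<K. S k) \<le> \<sigma>0\<^sup>2 + C * ds + real K * D2"
    using geometric_noise_sum_bound[of S \<rho> C d D2 K] s S0 by (simp add: S_def d_def ds_def)
  then have "T * (\<rho> * (\<Sum>k<K. S k)) \<le> T * (\<sigma>0\<^sup>2 + C * ds + real K * D2)"
    using nonneg by (intro mult_left_mono) auto
  moreover have "2 * B * (\<Sum>k<K. S k) \<le> T * \<rho> * (\<Sum>k<K. S k)"
    using step(2) by (intro mult_right_mono sum_nonneg) (auto simp: S_def)
  ultimately have BS: "2 * B * (\<Sum>k<K. S k) \<le> T * (\<sigma>0\<^sup>2 + C * ds + real K * D2)"
    by simp
  have "(\<integral>\<omega>. gap_majorant K \<omega> \<partial>M)
      \<le> (\<Sum>k<K. 2 * \<gamma>\<^sup>2 * (\<integral>\<omega>. (norm (gh k \<omega> - g k \<omega>))\<^sup>2 \<partial>M)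
            + \<gamma>\<^sup>2 * (\<integral>\<omega>. (norm (gh k \<omega> - F (zh k \<omega>)))\<^sup>2 \<partial>M)
            - (1 - \<tau>) / 2 * d k)"
    using gap_majorant_expectation(2)[OF ae] by (simp add: d_def)
  also have "\<dots> \<le> (\<Sum>k<K. 2 * \<gamma>\<^sup>2 * (A * d k + B * S k + D1) + \<gamma>\<^sup>2 * (E * d k + D3) - (1 - \<tau>) / 2 * d k)"
    unfolding d_def S_def by (intro sum_mono diff_mono add_mono mult_left_mono e n order_refl) auto
  also have "\<dots> = 2 * \<gamma>\<^sup>2 * (A * ds + B * (\<Sum>k<K. S k) + real K * D1) + \<gamma>\<^sup>2 * (E * ds + real K * D3) - (1 - \<tau>) / 2 * ds"
    unfolding ds_def sum.distrib sum_subtractf sum_distrib_left[symmetric] by simp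
  also have "\<dots> = \<gamma>\<^sup>2 * (2 * B * (\<Sum>k<K. S k)) + \<gamma>\<^sup>2 * (2 * A + E) * ds
      + \<gamma>\<^sup>2 * real K * (2 * D1 + D3) - (1 - \<tau>) / 2 * ds"
    by (simp add: algebra_simps)
  also have "\<dots> \<le> \<gamma>\<^sup>2 * (T * (\<sigma>0\<^sup>2 + C * ds + real K * D2)) + \<gamma>\<^sup>2 * (2 * A + E) * ds
      + \<gamma>\<^sup>2 * real K * (2 * D1 + D3) - (1 - \<tau>) / 2 * ds"
    using mult_left_mono[OF BS G] by simp
  also have "\<dots> = \<gamma>\<^sup>2 * T * \<sigma>0\<^sup>2 + \<gamma>\<^sup>2 * (2 * A + T * C + E) * ds
      + \<gamma>\<^sup>2 * real K * (2 * D1 + T * D2 + D3) - (1 - \<tau>) / 2 * ds"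
    by (simp add: algebra_simps)
  also have "\<dots> \<le> \<gamma>\<^sup>2 * T * \<sigma>0\<^sup>2 + \<gamma>\<^sup>2 * real K * (2 * D1 + T * D2 + D3)"
  proof -
    have "\<gamma>\<^sup>2 * (2 * A + T * C + E) * ds \<le> (1 - \<tau>) / 2 * ds"
      using step(1) tau ds0 by (intro mult_right_mono) auto
    then show ?thesis by simp
  qed
  finally have maj: "(\<integral>\<omega>. gap_majorant K \<omega> \<partial>M) \<le> \<gamma>\<^sup>2 * T * \<sigma>0\<^sup>2 + \<gamma>\<^sup>2 * real K * (2 * D1 + T * D2 + D3)" .
  have "(\<integral>\<omega>. Y \<omega> \<partial>M) = (7 * \<Delta> + (\<integral>\<omega>. gap_majorant K \<omega> \<partial>M)) / (2 * \<gamma> * real K)"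
    unfolding Y_def using gap_majorant_expectation(1)[OF ae] by (simp add: prob_space)
  \<comment> \<open>Only rounding: the coefficients reached are \<open>7/2\<close> and
    \<open>1/2\<close> in the first fraction and 1, \<open>1/2\<close>, \<open>1/2\<close> for
    \<open>D1\<close>, \<open>T * D2\<close>, \<open>D3\<close>.\<close>
  also have "\<dots> \<le> (16 * \<Delta> + (8 * \<gamma>\<^sup>2 * T * \<sigma>0\<^sup>2 + \<gamma>\<^sup>2 * real K * (2 * (7 * D1 + 3 * T * D2 + D3)))) / (2 * \<gamma> * real K)"
  proof (intro divide_right_mono add_mono)
    have "\<gamma>\<^sup>2 * T * \<sigma>0\<^sup>2 \<le> 8 * \<gamma>\<^sup>2 * T * \<sigma>0\<^sup>2"
      using nonneg by simp
    moreover have "\<gamma>\<^sup>2 * real K * (2 * D1 + T * D2 + D3) \<le> \<gamma>\<^sup>2 * real K * (2 * (7 * D1 + 3 * T * D2 + D3))"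
      using nonneg by (intro mult_left_mono) auto
    ultimately show "(\<integral>\<omega>. gap_majorant K \<omega> \<partial>M)
        \<le> 8 * \<gamma>\<^sup>2 * T * \<sigma>0\<^sup>2 + \<gamma>\<^sup>2 * real K * (2 * (7 * D1 + 3 * T * D2 + D3))"
      using maj by linarith
  qed (use \<Delta>0 gamma in auto)
  also have "\<dots> = (8 * \<Delta> + 4 * \<gamma>\<^sup>2 * T * \<sigma>0\<^sup>2) / (\<gamma> * real K) + \<gamma> * (7 * D1 + 3 * T * D2 + D3)"
    using gamma K by (simp add: field_simps power2_eq_square)
  finally have final: "(\<integral>\<omega>. Y \<omega> \<partial>M) \<le> (8 * \<Delta> + 4 * \<gamma>\<^sup>2 * T * \<sigma>0\<^sup>2) / (\<gamma> * real K)
      + \<gamma> * (7 * D1 + 3 * T * D2 + D3)" .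
  have "(\<integral>\<^sup>+\<omega>. e2ennreal (gap U F h (?zb \<omega>)) \<partial>M) \<le> (\<integral>\<^sup>+\<omega>. ennreal (Y \<omega>) \<partial>M)"
  proof (rule nn_integral_mono_AE)
    show "AE \<omega> in M. e2ennreal (gap U F h (?zb \<omega>)) \<le> ennreal (Y \<omega>)"
      using gap_le by eventually_elim (metis e2ennreal_mono e2ennreal_ereal)
  qed
  also have "\<dots> = ennreal (\<integral>\<omega>. Y \<omega> \<partial>M)"
    by (rule nn_integral_eq_integral[OF iY Y0])
  also have "\<dots> \<le> ennreal ((8 * \<Delta> + 4 * \<gamma>\<^sup>2 * T * \<sigma>0\<^sup>2) / (\<gamma> * real K) + \<gamma> * (7 * D1 + 3 * T * D2 + D3))"
    by (rule ennreal_leI[OF final])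
  finally show ?thesis by (simp only: \<Delta>_def)
qed

text \<open>Both expectations are nonnegative integrals, so each conclusion also asserts finiteness.
  As \<open>1 - \<tau>\<close> is positive, an extended-valued quotient with zero denominator is
  \<open>\<infinity>\<close>, as the convention on \<open>1/0\<close> demands.\<close>

theorem mainTheorem1:
  fixes M :: "'w measure"
    and h :: "'n::euclidean_space \<Rightarrow> ereal" and F :: "'n \<Rightarrow> 'n"
    and Z U :: "'n set" and zs z0 :: 'n
    and z zh w g gh :: "nat \<Rightarrow> 'w \<Rightarrow> 'n"
    and \<sigma> :: "nat \<Rightarrow> 'w \<Rightarrow> real" and \<sigma>0 :: real
    and R :: "nat \<Rightarrow> 'w set"
    and \<tau> \<gamma> \<rho> T A B C E D1 D2 D3 \<mu>F \<mu>h :: real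
    and K :: nat
  assumes "prob_space M"
    and "proper_fun h" "lsc_fun h" "convex_fun h"
    and "Z \<noteq> {}" "closed Z" "convex Z" "domain_of h \<subseteq> Z"
    and "vi_solution Z F h zs"
    and "0 \<le> \<tau>" "\<tau> < 1" "\<gamma> > 0"
    and "z0 \<in> Z"
    and "\<And>k. g k \<in> borel_measurable M" "\<And>k. gh k \<in> borel_measurable M"
    and "\<And>k. \<sigma> k \<in> borel_measurable M" "\<And>k. R k \<in> sets M"
    and "\<And>\<omega>. \<omega> \<in> space M \<Longrightarrow> z 0 \<omega> = z0" "\<And>\<omega>. \<omega> \<in> space M \<Longrightarrow> w 0 \<omega> = z0"
    and "\<And>\<omega>. \<omega> \<in> space M \<Longrightarrow> \<sigma> 0 \<omega> = \<sigma>0"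
    and "\<And>k \<omega>. \<omega> \<in> space M \<Longrightarrow>
           zh k \<omega> = prox \<gamma> h ((\<tau> *\<^sub>R z k \<omega> + (1 - \<tau>) *\<^sub>R w k \<omega>) - \<gamma> *\<^sub>R g k \<omega>)"
    and "\<And>k \<omega>. \<omega> \<in> space M \<Longrightarrow>
           z (Suc k) \<omega> = prox \<gamma> h ((\<tau> *\<^sub>R z k \<omega> + (1 - \<tau>) *\<^sub>R w k \<omega>) - \<gamma> *\<^sub>R gh k \<omega>)"
    and "\<And>k \<omega>. \<omega> \<in> space M \<Longrightarrow>
           w (Suc k) \<omega> = (if \<omega> \<in> R k then z (Suc k) \<omega> else w k \<omega>)"
    and "\<And>k. measure M (R k) = 1 - \<tau>"
    and "\<And>k. prob_space.indep_set M {R k} (sets (history_full M g gh \<sigma> R k))"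
    and "\<And>k. integrable M (gh k)"
    and "\<And>k. AE \<omega> in M.
           vec_cond_exp M (vimage_algebra (space M) (zh k) borel) (gh k) \<omega> = F (zh k \<omega>)"
    and "\<And>k. integrable M (\<lambda>\<omega>. (norm (gh k \<omega> - g k \<omega>))\<^sup>2)"
    and "\<And>k. integrable M (\<lambda>\<omega>. (norm (zh k \<omega> - w k \<omega>))\<^sup>2)"
    and "\<And>k. integrable M (\<lambda>\<omega>. (\<sigma> k \<omega>)\<^sup>2)"
    and "\<And>k. integrable M (\<lambda>\<omega>. (norm (gh k \<omega> - F (zh k \<omega>)))\<^sup>2)"
    and "A \<ge> 0" "B \<ge> 0" "C \<ge> 0" "E \<ge> 0" "D1 \<ge> 0" "D2 \<ge> 0" "D3 \<ge> 0" "0 < \<rho>" "\<rho> \<le> 1"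
    and "\<And>k. (\<integral>\<omega>. (norm (gh k \<omega> - g k \<omega>))\<^sup>2 \<partial>M)
           \<le> A * (\<integral>\<omega>. (norm (zh k \<omega> - w k \<omega>))\<^sup>2 \<partial>M) + B * (\<integral>\<omega>. (\<sigma> k \<omega>)\<^sup>2 \<partial>M) + D1"
    and "\<And>k. (\<integral>\<omega>. (\<sigma> (Suc k) \<omega>)\<^sup>2 \<partial>M)
           \<le> (1 - \<rho>) * (\<integral>\<omega>. (\<sigma> k \<omega>)\<^sup>2 \<partial>M) + C * (\<integral>\<omega>. (norm (zh k \<omega> - w k \<omega>))\<^sup>2 \<partial>M) + D2"
    and "\<And>k. (\<integral>\<omega>. (norm (gh k \<omega> - F (zh k \<omega>)))\<^sup>2 \<partial>M)
           \<le> E * (\<integral>\<omega>. (norm (zh k \<omega> - w k \<omega>))\<^sup>2 \<partial>M) + D3"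
    and "T > 0" "K \<ge> 1"
  shows
    "(\<mu>F \<ge> 0 \<and> \<mu>h \<ge> 0 \<and> \<mu>F + \<mu>h > 0 \<and>
      strongly_monotone_on Z F \<mu>F \<and> strongly_convex_on Z h \<mu>h \<and>
      ereal \<gamma> \<le> min (ereal (sqrt (1 - \<tau>)) / ereal (2 * sqrt (2 * A + T * C)))
                      (ereal (1 - \<tau>) / ereal (4 * (\<mu>F + \<mu>h))) \<and>
      T \<ge> 4 * B / \<rho>
      \<longrightarrow>
      (\<integral>\<^sup>+\<omega>. ennreal (lyapunov \<tau> T \<gamma> zs (z K \<omega>) (w K \<omega>) (\<sigma> K \<omega>)) \<partial>M)
        \<le> ennreal
            (max ((1 - \<gamma> * ((\<mu>F + \<mu>h) / 16)) ^ (K - 1)) ((1 - \<rho> / 2) ^ (K - 1))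
               * lyapunov \<tau> T \<gamma> zs z0 z0 \<sigma>0
             + \<gamma>\<^sup>2 * (2 * D1 + T * D2) / min (\<gamma> * ((\<mu>F + \<mu>h) / 16)) (\<rho> / 2)))
     \<and>
     (strongly_monotone_on Z F 0 \<and> strongly_convex_on Z h 0 \<and>
      compact U \<and> U \<subseteq> Z \<and> zs \<in> U \<and>
      (\<forall>k. AE \<omega> in M. vec_cond_exp M (history_half M g gh R k) (gh k) \<omega> = F (zh k \<omega>)) \<and>
      ereal \<gamma> \<le> ereal (sqrt (1 - \<tau>)) / ereal (2 * sqrt (2 * A + T * C + E)) \<and>
      T \<ge> 2 * B / \<rho>
      \<longrightarrow>
      (\<integral>\<^sup>+\<omega>. e2ennreal (gap U F h ((1 / real K) *\<^sub>R (\<Sum>k<K. zh k \<omega>))) \<partial>M)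
        \<le> ennreal
            ((8 * (SUP u\<in>U. (norm (z0 - u))\<^sup>2) + 4 * \<gamma>\<^sup>2 * T * \<sigma>0\<^sup>2) / (\<gamma> * real K)
             + \<gamma> * (7 * D1 + 3 * T * D2 + D3)))"
proof -
  interpret prob_space M by fact
  interpret stochastic_extragradient M h F Z zs z0 z zh w g gh \<sigma> R \<tau> \<gamma>
    by unfold_locales (fact assms)+
  show ?thesis
  proof (intro conjI impI; elim conjE)
    assume mu: "0 \<le> \<mu>F" "0 \<le> \<mu>h" "0 < \<mu>F + \<mu>h"
      and mono: "strongly_monotone_on Z F \<mu>F" "strongly_convex_on Z h \<mu>h"
      and step: "ereal \<gamma> \<le> min (ereal (sqrt (1 - \<tau>)) / ereal (2 * sqrt (2 * A + T * C)))
                      (ereal (1 - \<tau>) / ereal (4 * (\<mu>F + \<mu>h)))"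
      and T: "4 * B / \<rho> \<le> T"
    have 1: "4 * \<gamma>\<^sup>2 * (2 * A + T * C) \<le> 1 - \<tau>"
      using step \<open>A \<ge> 0\<close> \<open>C \<ge> 0\<close> \<open>T > 0\<close> tau gamma by (intro ereal_stepsize_bound) auto
    have 2: "4 * (\<gamma> * (\<mu>F + \<mu>h)) \<le> 1 - \<tau>"
      using step mu by (simp add: field_simps)
    have 3: "4 * B \<le> T * \<rho>"
      using T \<open>0 < \<rho>\<close> by (simp add: field_simps)
    show "(\<integral>\<^sup>+\<omega>. ennreal (lyapunov \<tau> T \<gamma> zs (z K \<omega>) (w K \<omega>) (\<sigma> K \<omega>)) \<partial>M)
        \<le> ennreal
            (max ((1 - \<gamma> * ((\<mu>F + \<mu>h) / 16)) ^ (K - 1)) ((1 - \<rho> / 2) ^ (K - 1))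
               * lyapunov \<tau> T \<gamma> zs z0 z0 \<sigma>0
             + \<gamma>\<^sup>2 * (2 * D1 + T * D2) / min (\<gamma> * ((\<mu>F + \<mu>h) / 16)) (\<rho> / 2))"
      by (rule lyapunov_linear_convergence[where A = A and B = B and C = C]) (fact assms mu mono 1 2 3)+
  next
    assume mono: "strongly_monotone_on Z F 0" and U: "compact U" "zs \<in> U"
      and ae: "\<forall>k. AE \<omega> in M. vec_cond_exp M (history_half M g gh R k) (gh k) \<omega> = F (zh k \<omega>)"
      and step: "ereal \<gamma> \<le> ereal (sqrt (1 - \<tau>)) / ereal (2 * sqrt (2 * A + T * C + E))"
      and T: "2 * B / \<rho> \<le> T"
    have 1: "4 * \<gamma>\<^sup>2 * (2 * A + T * C + E) \<le> 1 - \<tau>"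
      using step \<open>A \<ge> 0\<close> \<open>C \<ge> 0\<close> \<open>E \<ge> 0\<close> \<open>T > 0\<close> tau gamma by (intro ereal_stepsize_bound) auto
    have 2: "2 * B \<le> T * \<rho>"
      using T \<open>0 < \<rho>\<close> by (simp add: field_simps)
    show "(\<integral>\<^sup>+\<omega>. e2ennreal (gap U F h ((1 / real K) *\<^sub>R (\<Sum>k<K. zh k \<omega>))) \<partial>M)
        \<le> ennreal
            ((8 * (SUP u\<in>U. (norm (z0 - u))\<^sup>2) + 4 * \<gamma>\<^sup>2 * T * \<sigma>0\<^sup>2) / (\<gamma> * real K)
             + \<gamma> * (7 * D1 + 3 * T * D2 + D3))"
      by (rule ergodic_gap_bound[where A = A and B = B and C = C and E = E and \<rho> = \<rho>])
        (fact assms mono U 1 2 ae[rule_format])+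
  qed
qed

end
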